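(* Let $D$ be a bounded domain in $\mathbb{R}^m$, $m \geq 2$, and let $u \in C^0(D)$ be real-valued. If for some $\lambda > 0$ the equality $$\Gamma\left( \frac{m}{2} \right) \frac{J_{(m-2)/2}(\lambda r)}{(\lambda r/2)^{(m-2)/2}} \, u(x) = \frac{1}{|\partial B_r|} \int_{\partial B_r(x)} u(y) \, dS_y$$ holds for every $x \in D$ and all $r \in (0, r(x))$, where $r(x) > 0$ is such that the ball $B_{r(x)}(x)$ is admissible, then $u$ is metaharmonic in $D$, that is, $u$ satisfies $\nabla^2 u + \lambda^2 u = 0$ in $D$.
   Context: A domain is an open connected subset of $\mathbb{R}^m$. $B_r(x) = \{ y : |y-x| < r\}$; the ball is called admissible if $\overline{B_r(x)} \subset D$. $|\partial B_r| = 2\pi^{m/2} r^{m-1}/\Gamma(m/2)$ is the area of the sphere of radius $r$, $dS$ is the surface measure, and $J_\nu$ is the Bessel function of the first kind of order $\nu$. *)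

theory Defs
  imports "HOL-Analysis.Analysis"
begin

text \<open>Bessel function of the first kind of real order, for positive real argument.
  When \<open>k + \<nu> + 1\<close> is a pole of the Gamma function, HOL's \<open>Gamma\<close> is 0 and the term
  vanishes, as it should.\<close>

definition Bessel_J :: "real \<Rightarrow> real \<Rightarrow> real" where
  "Bessel_J \<nu> z =
     (\<Sum>k. (-1) ^ k / (fact k * Gamma (real k + \<nu> + 1)) * (z / 2) powr (2 * real k + \<nu>))"

text \<open>Surface measure on the sphere \<open>sphere c r\<close>, \<open>r > 0\<close>, in a Euclidean space of dimension \<open>m\<close>:
  the area of a Borel set \<open>E\<close> on the sphere is \<open>m / r\<close> times the volume of the cone over \<open>E\<close> with
  apex \<open>c\<close>. The measure lives on the sphere itself (not on the whole space), so that a function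
  only needs to be measurable on the sphere in order to be integrated.\<close>

definition sphere_measure :: "'a::euclidean_space \<Rightarrow> real \<Rightarrow> 'a measure" where
  "sphere_measure c r =
     scale_measure (ennreal (real DIM('a) / r))
       (distr (restrict_space lborel (ball c r - {c}))
              (restrict_space borel (sphere c r))
              (\<lambda>y. c + (r / norm (y - c)) *\<^sub>R (y - c)))"

definition sphere_area :: "nat \<Rightarrow> real \<Rightarrow> real" where
  "sphere_area m r = 2 * pi powr (real m / 2) * r ^ (m - 1) / Gamma (real m / 2)"

lemma radial_projection_measurable:
  fixes c :: "'a::euclidean_space"
  assumes "r > 0"
  shows "(\<lambda>y. c + (r / norm (y - c)) *\<^sub>R (y - c)) \<in>
    restrict_space lborel (ball c r - {c}) \<rightarrow>\<^sub>M restrict_space borel (sphere c r)"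
proof (rule measurable_restrict_space2)
  show "(\<lambda>y. c + (r / norm (y - c)) *\<^sub>R (y - c)) \<in>
      space (restrict_space lborel (ball c r - {c})) \<rightarrow> sphere c r"
    using assms by (auto simp: space_restrict_space dist_norm)
  show "(\<lambda>y. c + (r / norm (y - c)) *\<^sub>R (y - c)) \<in>
      restrict_space lborel (ball c r - {c}) \<rightarrow>\<^sub>M borel"
    by (rule measurable_restrict_space1) measurable
qed

text \<open>The total mass of the surface measure is the area of the sphere.\<close>

lemma emeasure_sphere_measure:
  fixes c :: "'a::euclidean_space"
  assumes "r > 0"
  shows "emeasure (sphere_measure c r) (sphere c r) = ennreal (sphere_area DIM('a) r)"
proof -
  let ?f = "\<lambda>y. c + (r / norm (y - c)) *\<^sub>R (y - c)"
  let ?M = "restrict_space lborel (ball c r - {c})"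
  define m where "m = DIM('a)"
  have m: "m > 0"
    by (simp add: m_def)
  have "?f -` sphere c r \<inter> space ?M = ball c r - {c}"
    using assms by (auto simp: space_restrict_space dist_norm)
  moreover have "sphere c r \<in> sets (restrict_space borel (sphere c r))"
    by (simp add: sets_restrict_space_iff)
  ultimately have "emeasure (sphere_measure c r) (sphere c r) =
      ennreal (real m / r) * emeasure ?M (ball c r - {c})"
    unfolding sphere_measure_def m_def
    using radial_projection_measurable[OF assms, of c] by (simp add: emeasure_distr)
  also have "emeasure ?M (ball c r - {c}) = emeasure lborel (ball c r - {c})"
    by (rule emeasure_restrict_space) auto
  also have "\<dots> = emeasure lborel (ball c r)"
    by (intro emeasure_Diff_null_set) (auto simp: null_sets_def)
  also have "\<dots> = ennreal (unit_ball_vol m * r ^ m)"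
    using assms by (simp add: emeasure_ball m_def)
  also have "ennreal (real m / r) * \<dots> = ennreal (real m / r * (unit_ball_vol m * r ^ m))"
    using assms by (intro ennreal_mult' [symmetric]) auto
  also have "real m / r * (unit_ball_vol m * r ^ m) = sphere_area m r"
  proof -
    have "real m / 2 \<notin> \<int>\<^sub>\<le>\<^sub>0"
      using m by (auto elim!: nonpos_Ints_cases)
    then have G: "Gamma (real m / 2 + 1) = real m / 2 * Gamma (real m / 2)"
      by (rule Gamma_plus1)
    have "r ^ m = r * r ^ (m - 1)"
      using m by (metis power_eq_if less_numeral_extra(3))
    moreover have "Gamma (real m / 2) > 0"
      using m by (intro Gamma_real_pos) simp
    ultimately show ?thesis
      using assms m by (simp add: unit_ball_vol_def sphere_area_def G)
  qed
  finally show ?thesis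
    by (simp add: m_def)
qed

definition partial_deriv :: "'a::euclidean_space \<Rightarrow> ('a \<Rightarrow> real) \<Rightarrow> 'a \<Rightarrow> real" where
  "partial_deriv b f x = deriv (\<lambda>t. f (x + t *\<^sub>R b)) 0"

text \<open>The following notions are meant for open sets \<open>S\<close>: the derivatives at a point of \<open>S\<close> then
  depend only on the values of the function in \<open>S\<close>.\<close>

definition C1_on :: "'a::euclidean_space set \<Rightarrow> ('a \<Rightarrow> real) \<Rightarrow> bool" where
  "C1_on S f \<longleftrightarrow>
     (\<forall>b\<in>Basis. (\<forall>x\<in>S. (\<lambda>t. f (x + t *\<^sub>R b)) field_differentiable at 0) \<and>
                continuous_on S (partial_deriv b f))"

definition C2_on :: "'a::euclidean_space set \<Rightarrow> ('a \<Rightarrow> real) \<Rightarrow> bool" where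
  "C2_on S f \<longleftrightarrow> C1_on S f \<and> (\<forall>b\<in>Basis. C1_on S (partial_deriv b f))"

definition laplacian :: "('a::euclidean_space \<Rightarrow> real) \<Rightarrow> 'a \<Rightarrow> real" where
  "laplacian f x = (\<Sum>b\<in>Basis. partial_deriv b (partial_deriv b f) x)"

definition metaharmonic_on :: "real \<Rightarrow> 'a::euclidean_space set \<Rightarrow> ('a \<Rightarrow> real) \<Rightarrow> bool" where
  "metaharmonic_on k S f \<longleftrightarrow> C2_on S f \<and> (\<forall>x\<in>S. laplacian f x + k\<^sup>2 * f x = 0)"

end

theory Submission
  imports Defs "HOL-Library.Function_Algebras" "HOL-Real_Asymp.Real_Asymp"
begin

text \<open>The radii \<open>\<rho> x\<close> need not be bounded below locally, so \<open>u\<close> cannot simply be mollified.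
  Instead, \<open>U(x, t) = u x * exp (lam * t)\<close> is compared with harmonic functions on small balls of
  \<open>\<real>\<^sup>m \<times> \<real>\<close>: a Laplacian built from spherical means in \<open>x\<close> and second differences in \<open>t\<close>
  vanishes on \<open>U\<close> at every point, and this pointwise information suffices for a maximum principle.
  On a ball, the Dirichlet problem for the Laplacian with polynomial data has a polynomial
  solution, because \<open>q \<mapsto> \<Delta>((R\<^sup>2 - |z|\<^sup>2) q)\<close> is an injective, hence surjective, endomorphism of
  the polynomials of degree at most \<open>k\<close>. By the Stone-Weierstrass theorem and the maximum principle,
  \<open>U\<close> is locally a uniform limit of harmonic polynomials; Bernstein's gradient bound carries this
  over to the derivatives, so \<open>U\<close> is harmonic and \<open>u = U(\<cdot>, 0)\<close> is metaharmonic.\<close>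

section \<open>Partial derivatives of polynomial functions\<close>

text \<open>The identity is exploited at each fixed centre through its limit as r tends to 0. There
  the normalised Bessel factor is 1 - lam^2 r^2 / (2m) + o(r^2), with m the dimension of the space
  of x, so spherical means see the Laplacian of \<open>u\<close> as -lam^2 u. The second difference
  of exp (lam t) contributes +lam^2, which is why this exponential is the right partner. The extra
  variable removes the zero order term lam^2 u, whose sign is unfavourable for a maximum principle:
  for the pure Laplacian, comparison works on balls of every radius. It also makes the operator
  lower degrees by two, so that the Dirichlet problem for polynomials becomes finite-dimensional
  linear algebra and takes the place of the Poisson integral. In every comparison the derivatives
  fall on the polynomial; \<open>U\<close> itself only has to be continuous with vanishing mean
  Laplacian. Its differentiability appears at the end, when bounds for differences of harmonic
  polynomials make their derivatives converge.\<close>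

lemma poly_sum:
  "finite I \<Longrightarrow> (\<And>i. i \<in> I \<Longrightarrow> real_polynomial_function (f i)) \<Longrightarrow>
    real_polynomial_function (\<lambda>x. \<Sum>i\<in>I. f i x)"
  by (rule real_polynomial_function_sum)

lemma poly_inner: "real_polynomial_function (\<lambda>x. x \<bullet> c)"
  by (simp add: bounded_linear_inner_left real_polynomial_function.intros)

lemmas poly_const = real_polynomial_function.intros(2)
lemmas poly_mult = real_polynomial_function.intros(4)
lemmas poly_intros = poly_const real_polynomial_function.intros(3) poly_mult poly_inner poly_sum
  real_polynomial_function_diff real_polynomial_function_minus real_polynomial_function_power

lemma has_derivative_line:
  fixes f :: "'a::euclidean_space \<Rightarrow> real"
  assumes "(f has_derivative f') (at (x + t *\<^sub>R b))"
  shows "((\<lambda>s. f (x + s *\<^sub>R b)) has_field_derivative f' b) (at t)"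
proof -
  have "((\<lambda>s. x + s *\<^sub>R b) has_derivative (\<lambda>s. s *\<^sub>R b)) (at t)"
    by (auto intro!: derivative_eq_intros)
  from has_derivative_compose[OF this assms]
  have "((\<lambda>s. f (x + s *\<^sub>R b)) has_derivative (\<lambda>s. f' (s *\<^sub>R b))) (at t)" .
  moreover have "f' (s *\<^sub>R b) = f' b * s" for s
    using has_derivative_linear[OF assms] by (simp add: linear_cmul)
  ultimately show ?thesis
    by (simp add: has_field_derivative_def)
qed

lemma partial_deriv_eq:
  assumes "(f has_derivative f') (at x)"
  shows "partial_deriv b f x = f' b"
  unfolding partial_deriv_def
  using assms by (intro DERIV_imp_deriv has_derivative_line) simp

text \<open>\<open>partial_deriv\<close> is a bare \<open>deriv\<close> along a line; total
  differentiability is what expresses the derivative in every direction through those along the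
  basis.\<close>

lemma poly_has_derivative:
  fixes p :: "'a::euclidean_space \<Rightarrow> real"
  assumes "real_polynomial_function p"
  shows "(p has_derivative (\<lambda>h. \<Sum>b\<in>Basis. (h \<bullet> b) * partial_deriv b p x)) (at x)"
proof -
  obtain p' where p': "(p has_derivative p') (at x)"
    using differentiable_at_real_polynomial_function[OF assms] by (auto simp: differentiable_def)
  interpret linear p' using has_derivative_linear[OF p'] .
  have "p' h = (\<Sum>b\<in>Basis. (h \<bullet> b) * partial_deriv b p x)" for h
  proof -
    have "p' h = p' (\<Sum>b\<in>Basis. (h \<bullet> b) *\<^sub>R b)"
      by (simp add: euclidean_representation)
    also have "\<dots> = (\<Sum>b\<in>Basis. (h \<bullet> b) * partial_deriv b p x)"
      by (simp add: sum scale partial_deriv_eq[OF p'])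
    finally show ?thesis .
  qed
  then have "p' = (\<lambda>h. \<Sum>b\<in>Basis. (h \<bullet> b) * partial_deriv b p x)" ..
  with p' show ?thesis by simp
qed

lemma poly_has_derivative_line:
  assumes "real_polynomial_function p"
  shows "((\<lambda>s. p (x + s *\<^sub>R h)) has_field_derivative
    (\<Sum>b\<in>Basis. (h \<bullet> b) * partial_deriv b p (x + t *\<^sub>R h))) (at t)"
  by (rule has_derivative_line[OF poly_has_derivative[OF assms]])

lemma poly_has_partial_deriv:
  fixes p :: "'a::euclidean_space \<Rightarrow> real"
  assumes "real_polynomial_function p" and b: "b \<in> Basis"
  shows "((\<lambda>s. p (x + s *\<^sub>R b)) has_field_derivative partial_deriv b p (x + t *\<^sub>R b)) (at t)"
proof -
  have "(\<Sum>c\<in>Basis. (b \<bullet> c) * partial_deriv c p (x + t *\<^sub>R b)) = partial_deriv b p (x + t *\<^sub>R b)"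
    using b by (simp add: inner_Basis if_distrib[of "\<lambda>x. x * _"] cong: if_cong)
  then show ?thesis
    using poly_has_derivative_line[OF assms(1), of x b t] by simp
qed

lemma poly_continuous_on:
  fixes p :: "'a::euclidean_space \<Rightarrow> real"
  assumes "real_polynomial_function p"
  shows "continuous_on S p"
  using assms
  by (meson continuous_at_imp_continuous_on continuous_real_polymonial_function)

section \<open>Algebra of partial derivatives and Laplacians of polynomials\<close>

lemma partial_deriv_const [simp]: "partial_deriv b (\<lambda>x. c) = (\<lambda>x. 0)"
  by (simp add: partial_deriv_def fun_eq_iff)

lemma partial_deriv_inner [simp]: "partial_deriv b (\<lambda>x. x \<bullet> c) = (\<lambda>x. b \<bullet> c)"
proof
  fix x :: 'a
  have "((\<lambda>x. x \<bullet> c) has_derivative (\<lambda>x. x \<bullet> c)) (at x)"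
    by (auto intro!: derivative_eq_intros)
  then show "partial_deriv b (\<lambda>x. x \<bullet> c) x = b \<bullet> c"
    by (rule partial_deriv_eq)
qed

lemma partial_deriv_add:
  assumes "real_polynomial_function p" "real_polynomial_function q"
  shows "partial_deriv b (\<lambda>x. p x + q x) = (\<lambda>x. partial_deriv b p x + partial_deriv b q x)"
proof
  fix x
  obtain p' q' where d: "(p has_derivative p') (at x)" "(q has_derivative q') (at x)"
    using poly_has_derivative assms by blast
  show "partial_deriv b (\<lambda>x. p x + q x) x = partial_deriv b p x + partial_deriv b q x"
    using partial_deriv_eq[OF has_derivative_add[OF d]] partial_deriv_eq[OF d(1)]
      partial_deriv_eq[OF d(2)] by simp
qed

lemma partial_deriv_mult:
  assumes "real_polynomial_function p" "real_polynomial_function q"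
  shows "partial_deriv b (\<lambda>x. p x * q x) =
    (\<lambda>x. p x * partial_deriv b q x + partial_deriv b p x * q x)"
proof
  fix x
  obtain p' q' where d: "(p has_derivative p') (at x)" "(q has_derivative q') (at x)"
    using poly_has_derivative assms by blast
  show "partial_deriv b (\<lambda>x. p x * q x) x = p x * partial_deriv b q x + partial_deriv b p x * q x"
    using partial_deriv_eq[OF has_derivative_mult[OF d]] partial_deriv_eq[OF d(1)]
      partial_deriv_eq[OF d(2)] by simp
qed

lemma partial_deriv_cmult:
  assumes "real_polynomial_function p"
  shows "partial_deriv b (\<lambda>x. c * p x) = (\<lambda>x. c * partial_deriv b p x)"
  using partial_deriv_mult[OF poly_const assms, of b c] by simp

lemma partial_deriv_diff:
  assumes "real_polynomial_function p" "real_polynomial_function q"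
  shows "partial_deriv b (\<lambda>x. p x - q x) = (\<lambda>x. partial_deriv b p x - partial_deriv b q x)"
  using partial_deriv_add[OF assms(1) poly_mult[OF poly_const assms(2)], of b "-1"]
    partial_deriv_cmult[OF assms(2), of b "-1"] by simp

lemma poly_partial_deriv [intro]:
  assumes "real_polynomial_function p"
  shows "real_polynomial_function (partial_deriv b p)"
  using assms
proof (induction p rule: real_polynomial_function.induct)
  case (linear f)
  have "partial_deriv b f = (\<lambda>x. f b)"
    using bounded_linear_imp_has_derivative[OF linear] partial_deriv_eq by blast
  then show ?case by auto
next
  case (const c)
  then show ?case by auto
next
  case (add f g)
  then show ?case by (auto simp: partial_deriv_add)
next
  case (mult f g)
  then show ?case by (auto simp: partial_deriv_mult)
qed

text \<open>Induction on the construction of a polynomial replaces Schwarz's theorem: the product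
  rule is symmetric in the two directions.\<close>

lemma partial_deriv_commute_poly:
  fixes p :: "'a::euclidean_space \<Rightarrow> real"
  assumes "real_polynomial_function p" "b \<in> Basis" "c \<in> Basis"
  shows "partial_deriv b (partial_deriv c p) = partial_deriv c (partial_deriv b p)"
  using assms(1)
proof (induction p rule: real_polynomial_function.induct)
  case (linear f)
  have "partial_deriv b f = (\<lambda>x. f b)" for b
    using bounded_linear_imp_has_derivative[OF linear] partial_deriv_eq by blast
  then show ?case by simp
next
  case (add f g)
  then show ?case by (simp add: partial_deriv_add poly_partial_deriv)
next
  case (mult f g)
  then show ?case
    by (simp add: partial_deriv_mult partial_deriv_add poly_partial_deriv
        poly_mult algebra_simps)
qed simp

lemma poly_laplacian:
  "real_polynomial_function p \<Longrightarrow> real_polynomial_function (laplacian p)"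
  unfolding laplacian_def[abs_def] by (intro poly_sum poly_partial_deriv) auto

lemma laplacian_add:
  assumes "real_polynomial_function p" "real_polynomial_function q"
  shows "laplacian (\<lambda>x. p x + q x) = (\<lambda>x. laplacian p x + laplacian q x)"
  using assms
  by (simp add: laplacian_def[abs_def] partial_deriv_add poly_partial_deriv sum.distrib)

lemma laplacian_diff:
  assumes "real_polynomial_function p" "real_polynomial_function q"
  shows "laplacian (\<lambda>x. p x - q x) = (\<lambda>x. laplacian p x - laplacian q x)"
  using assms
  by (simp add: laplacian_def[abs_def] partial_deriv_diff poly_partial_deriv sum_subtractf)

lemma laplacian_cmult:
  assumes "real_polynomial_function p"
  shows "laplacian (\<lambda>x. c * p x) = (\<lambda>x. c * laplacian p x)"
  using assms
  by (simp add: laplacian_def[abs_def] partial_deriv_cmult poly_partial_deriv sum_distrib_left)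

lemma laplacian_const [simp]: "laplacian (\<lambda>x. c) = (\<lambda>x. 0)"
  by (simp add: laplacian_def[abs_def])

lemma laplacian_mult:
  assumes p: "real_polynomial_function p" and q: "real_polynomial_function q"
  shows "laplacian (\<lambda>x. p x * q x) = (\<lambda>x. p x * laplacian q x + laplacian p x * q x +
    2 * (\<Sum>b\<in>Basis. partial_deriv b p x * partial_deriv b q x))"
  using assms
  by (simp add: laplacian_def[abs_def] partial_deriv_mult partial_deriv_add poly_partial_deriv
      poly_mult sum.distrib sum_distrib_left sum_distrib_right algebra_simps)

text \<open>Partial derivatives of harmonic polynomials are therefore harmonic, so the gradient
  bound can be applied to them and iterated.\<close>

lemma laplacian_partial_deriv:
  fixes p :: "'a::euclidean_space \<Rightarrow> real"
  assumes p: "real_polynomial_function p" and c: "c \<in> Basis"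
  shows "laplacian (partial_deriv c p) = partial_deriv c (laplacian p)"
proof -
  have "partial_deriv c (\<lambda>x. \<Sum>b\<in>A. partial_deriv b (partial_deriv b p) x) =
      (\<lambda>x. \<Sum>b\<in>A. partial_deriv c (partial_deriv b (partial_deriv b p)) x)"
    if "finite A" for A :: "'a set"
    using that
  proof (induction A rule: finite_induct)
    case (insert b A)
    have "real_polynomial_function (\<lambda>x. \<Sum>b\<in>A. partial_deriv b (partial_deriv b p) x)"
      using insert p by (intro poly_sum poly_partial_deriv) auto
    with insert p show ?case
      by (simp add: partial_deriv_add poly_partial_deriv)
  qed simp
  moreover have "partial_deriv b (partial_deriv b (partial_deriv c p)) =
      partial_deriv c (partial_deriv b (partial_deriv b p))" if "b \<in> Basis" for b
    using p that c by (metis partial_deriv_commute_poly poly_partial_deriv)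
  ultimately show ?thesis
    by (simp add: laplacian_def[abs_def])
qed

text \<open>Positive inside the sphere, zero on it, with constant negative Laplacian. It serves as
  the strict correction in the weak maximum principle, as the factor in the Dirichlet problem and as
  the cut-off in the gradient bound.\<close>

definition sphere_poly :: "'a::euclidean_space \<Rightarrow> real \<Rightarrow> 'a \<Rightarrow> real" where
  "sphere_poly z0 R z = R\<^sup>2 - (norm (z - z0))\<^sup>2"

text \<open>The coordinate form, to which the closure rules for polynomials and the degree count
  apply.\<close>

lemma sphere_poly_altdef:
  "sphere_poly z0 R = (\<lambda>z. (R\<^sup>2 - z0 \<bullet> z0) - ((\<Sum>b\<in>Basis. (z \<bullet> b) * (z \<bullet> b)) - 2 * (z \<bullet> z0)))"
  unfolding sphere_poly_def power2_norm_eq_inner euclidean_inner[symmetric]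
  by (simp add: fun_eq_iff inner_diff_left inner_diff_right inner_commute algebra_simps)

lemma poly_sphere_poly: "real_polynomial_function (sphere_poly z0 R)"
  unfolding sphere_poly_altdef by (intro poly_intros) auto

lemma partial_deriv_sphere_poly:
  "partial_deriv b (sphere_poly z0 R) = (\<lambda>z. - 2 * ((z - z0) \<bullet> b))"
proof
  fix z
  have "(sphere_poly z0 R has_derivative (\<lambda>h. - 2 * ((z - z0) \<bullet> h))) (at z)"
    unfolding sphere_poly_def[abs_def] power2_norm_eq_inner
    by (auto intro!: derivative_eq_intros simp: inner_commute)
  then show "partial_deriv b (sphere_poly z0 R) z = - 2 * ((z - z0) \<bullet> b)"
    by (rule partial_deriv_eq)
qed

lemma laplacian_sphere_poly:
  "laplacian (sphere_poly (z0::'a::euclidean_space) R) = (\<lambda>z. - 2 * real DIM('a))"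
proof -
  have "(\<lambda>z. - 2 * ((z - z0) \<bullet> b)) = (\<lambda>z. 2 * (z0 \<bullet> b) - 2 * (z \<bullet> b))" for b
    by (simp add: fun_eq_iff inner_diff_left algebra_simps)
  moreover have "partial_deriv c (\<lambda>z. 2 * (z0 \<bullet> b) - 2 * (z \<bullet> b)) = (\<lambda>z. - 2 * (c \<bullet> b))" for b c
    by (subst partial_deriv_diff)
      (auto simp: partial_deriv_cmult[OF poly_inner] intro!: poly_intros)
  ultimately show ?thesis
    by (simp add: laplacian_def[abs_def] partial_deriv_sphere_poly fun_eq_iff)
qed

text \<open>Maclaurin's formula along the segment from \<open>x\<close> to \<open>x + h\<close>
  leaves a remainder at an intermediate point; continuity of the finitely many second derivatives
  allows it to be moved to \<open>x\<close>. An error of this size stays small after division by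
  r^2, as spherical means and second differences require.\<close>

lemma poly_taylor2:
  fixes p :: "'a::euclidean_space \<Rightarrow> real"
  assumes p: "real_polynomial_function p" and "e > 0"
  obtains d where "d > 0" "\<And>h. norm h < d \<Longrightarrow>
    \<bar>p (x + h) - p x - (\<Sum>b\<in>Basis. (h \<bullet> b) * partial_deriv b p x) -
      (\<Sum>b\<in>Basis. \<Sum>c\<in>Basis. (h \<bullet> b) * (h \<bullet> c) * partial_deriv c (partial_deriv b p) x) / 2\<bar>
    \<le> e * (norm h)\<^sup>2"
proof -
  let ?H = "\<lambda>b c. partial_deriv c (partial_deriv b p)"
  \<comment> \<open>The second order term has DIM^2 summands, each of which is allowed an error
    \<open>e'\<close> times |h|^2.\<close>
  define e' where "e' = e / real (DIM('a) * DIM('a))"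
  have e': "e' > 0" using \<open>e > 0\<close> by (simp add: e'_def)
  have pH: "real_polynomial_function (?H b c)" for b c
    using p by auto
  have "\<forall>\<^sub>F y in nhds x. \<forall>b\<in>Basis. \<forall>c\<in>Basis. dist (?H b c y) (?H b c x) < e'"
  proof (intro eventually_ball_finite ballI finite_Basis)
    fix b c :: 'a
    have "isCont (?H b c) x"
      using continuous_real_polymonial_function[OF pH] .
    then show "\<forall>\<^sub>F y in nhds x. dist (?H b c y) (?H b c x) < e'"
      using e' unfolding isCont_def tendsto_at_iff_tendsto_nhds by (rule tendstoD)
  qed
  then obtain d where d: "d > 0"
    and H: "\<And>y b c. dist y x < d \<Longrightarrow> b \<in> Basis \<Longrightarrow> c \<in> Basis \<Longrightarrow> dist (?H b c y) (?H b c x) < e'"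
    unfolding eventually_nhds_metric by blast
  show thesis
  proof (rule that[OF d])
    fix h :: 'a assume h: "norm h < d"
    define g1 where "g1 t = (\<Sum>b\<in>Basis. (h \<bullet> b) * partial_deriv b p (x + t *\<^sub>R h))" for t
    define g2 where "g2 t = (\<Sum>b\<in>Basis. \<Sum>c\<in>Basis. (h \<bullet> b) * (h \<bullet> c) * ?H b c (x + t *\<^sub>R h))" for t
    \<comment> \<open>The sequence of derivatives that \<open>Maclaurin2\<close> expects; only its
      entries 0, 1 and 2 matter.\<close>
    define D where "D m t = (if m = 0 then p (x + t *\<^sub>R h) else if m = 1 then g1 t else g2 t)"
      for m :: nat and t :: real
    have 0: "((\<lambda>t. p (x + t *\<^sub>R h)) has_field_derivative g1 t) (at t)" for t
      unfolding g1_def using p by (rule poly_has_derivative_line)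
    have 1: "(g1 has_field_derivative g2 t) (at t)" for t
      unfolding g1_def[abs_def] g2_def mult.assoc sum_distrib_left[symmetric]
      by (intro DERIV_sum DERIV_cmult poly_has_derivative_line poly_partial_deriv p)
    have "\<exists>t>0. t \<le> 1 \<and> D 0 1 = (\<Sum>m<2. D m 0 / fact m * 1 ^ m) + D 2 t / fact 2 * 1 ^ 2"
    proof (rule Maclaurin2)
      show "\<forall>m t. m < 2 \<and> 0 \<le> t \<and> t \<le> 1 \<longrightarrow> (D m has_real_derivative D (Suc m) t) (at t)"
        using 0 1 by (auto simp: D_def[abs_def] less_Suc_eq numeral_2_eq_2)
    qed auto
    then obtain t where t: "0 < t" "t \<le> 1" and eq: "p (x + h) = p x + g1 0 + g2 t / 2"
      by (auto simp: D_def eval_nat_numeral)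
    have "\<bar>g2 t - g2 0\<bar> \<le> (\<Sum>b\<in>(Basis::'a set). \<Sum>c\<in>(Basis::'a set). (norm h)\<^sup>2 * e')"
      unfolding g2_def sum_subtractf[symmetric]
    proof (intro order_trans[OF sum_abs] sum_mono)
      fix b c :: 'a assume bc: "b \<in> Basis" "c \<in> Basis"
      have "dist (x + t *\<^sub>R h) x < d"
        using t h by (simp add: dist_norm) (smt (verit) mult_left_le_one_le norm_ge_zero)
      then have 1: "\<bar>?H b c (x + t *\<^sub>R h) - ?H b c x\<bar> \<le> e'"
        using H[OF _ bc] by (simp add: dist_real_def less_imp_le)
      have 2: "\<bar>h \<bullet> b\<bar> * \<bar>h \<bullet> c\<bar> \<le> norm h * norm h"
        using bc by (intro mult_mono Basis_le_norm) auto
      have "\<bar>h \<bullet> b\<bar> * \<bar>h \<bullet> c\<bar> * \<bar>?H b c (x + t *\<^sub>R h) - ?H b c x\<bar> \<le> (norm h)\<^sup>2 * e'"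
        unfolding power2_eq_square[of "norm h"] by (rule mult_mono[OF 2 1]) auto
      then show "\<bar>(h \<bullet> b) * (h \<bullet> c) * ?H b c (x + t *\<^sub>R h) -
          (h \<bullet> b) * (h \<bullet> c) * ?H b c (x + 0 *\<^sub>R h)\<bar> \<le> (norm h)\<^sup>2 * e'"
        by (simp add: abs_mult flip: right_diff_distrib)
    qed
    also have "\<dots> = e * (norm h)\<^sup>2"
      by (simp add: e'_def)
    finally have "\<bar>g2 t - g2 0\<bar> / 2 \<le> e * (norm h)\<^sup>2"
      using \<open>e > 0\<close> by (smt (verit) half_gt_zero_iff field_sum_of_halves)
    moreover have "p (x + h) - p x - g1 0 - g2 0 / 2 = (g2 t - g2 0) / 2"
      using eq by (simp add: field_simps)
    ultimately show "\<bar>p (x + h) - p x - (\<Sum>b\<in>Basis. (h \<bullet> b) * partial_deriv b p x) -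
      (\<Sum>b\<in>Basis. \<Sum>c\<in>Basis. (h \<bullet> b) * (h \<bullet> c) * ?H b c x) / 2\<bar> \<le> e * (norm h)\<^sup>2"
      by (simp add: g1_def g2_def)
  qed
qed

section \<open>Spherical means\<close>

lemma sphere_area_pos:
  assumes "r > 0" "m > 0"
  shows "sphere_area m r > 0"
  using assms by (simp add: sphere_area_def Gamma_real_pos)

lemma sets_sphere_measure [measurable_cong]:
  "sets (sphere_measure c r) = sets (restrict_space borel (sphere c r))"
  by (simp add: sphere_measure_def)

lemma space_sphere_measure [simp]: "space (sphere_measure c r) = sphere c r"
  by (simp add: sphere_measure_def space_scale_measure space_restrict_space)

lemma measure_sphere_measure:
  fixes c :: "'a::euclidean_space"
  assumes "r > 0"
  shows "measure (sphere_measure c r) (sphere c r) = sphere_area DIM('a) r"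
  using emeasure_sphere_measure[OF assms, of c] sphere_area_pos[OF assms, of "DIM('a)"]
  by (simp add: measure_def)

lemma finite_measure_sphere_measure:
  "r > 0 \<Longrightarrow> finite_measure (sphere_measure (c::'a::euclidean_space) r)"
  by (rule finite_measureI) (simp add: emeasure_sphere_measure)

lemma integrable_sphere_measure:
  fixes f :: "'a::euclidean_space \<Rightarrow> real"
  assumes "r > 0" and f: "continuous_on (sphere c r) f"
  shows "integrable (sphere_measure c r) f"
proof -
  interpret finite_measure "sphere_measure c r"
    by (rule finite_measure_sphere_measure) fact
  have "bounded (f ` sphere c r)"
    using f by (intro compact_imp_bounded compact_continuous_image) auto
  then obtain B where "\<And>x. x \<in> sphere c r \<Longrightarrow> norm (f x) \<le> B"
    unfolding bounded_iff by blast
  moreover have "f \<in> borel_measurable (sphere_measure c r)"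
    unfolding measurable_cong_sets[OF sets_sphere_measure refl]
    using f by (rule borel_measurable_continuous_on_restrict)
  ultimately show ?thesis
    by (intro integrable_const_bound[where B = B] AE_I2) auto
qed

text \<open>Unfolding the cone construction and translating the centre to 0 gives a Lebesgue
  integral over a punctured ball, where the symmetries of \<open>lborel\<close> can be used.\<close>

lemma integral_sphere_measure:
  fixes f :: "'a::euclidean_space \<Rightarrow> real"
  assumes r: "r > 0" and f: "continuous_on (sphere c r) f"
  shows "(\<integral>y. f y \<partial>sphere_measure c r) = real DIM('a) / r *
    (\<integral>y. indicator (ball 0 r - {0}) y * f (c + (r / norm y) *\<^sub>R y) \<partial>lborel)"
proof -
  let ?p = "\<lambda>y. c + (r / norm (y - c)) *\<^sub>R (y - c)"
  let ?B = "restrict_space lborel (ball c r - {c})" and ?S = "restrict_space borel (sphere c r)"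
  let ?k = "real DIM('a) / r"
  have fm: "f \<in> borel_measurable ?S"
    using f by (rule borel_measurable_continuous_on_restrict)
  have pm: "?p \<in> ?B \<rightarrow>\<^sub>M ?S"
    by (rule radial_projection_measurable) fact
  \<comment> \<open>A scaled measure is one with constant density, and a density can be moved into
    the integrand.\<close>
  have "sphere_measure c r = density (distr ?B ?S ?p) (\<lambda>_. ennreal ?k)"
    unfolding sphere_measure_def
    by (rule measure_eqI) (auto simp: emeasure_density_const)
  then have "(\<integral>y. f y \<partial>sphere_measure c r) =
      (\<integral>y. f y \<partial>density (distr ?B ?S ?p) (\<lambda>_. ennreal ?k))"
    by simp
  also have "\<dots> = (\<integral>y. ?k * f y \<partial>distr ?B ?S ?p)"
    using r fm by (subst integral_density) auto
  also have "\<dots> = ?k * (\<integral>y. f (?p y) \<partial>?B)"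
    using integral_distr[OF pm fm] by simp
  also have "(\<integral>y. f (?p y) \<partial>?B) = (\<integral>y. indicator (ball c r - {c}) y * f (?p y) \<partial>lborel)"
    by (subst integral_restrict_space) auto
  also have "\<dots> = (\<integral>y. indicator (ball c r - {c}) (c + y) * f (?p (c + y)) \<partial>lborel)"
    (is "integral\<^sup>L lborel ?g = _")
  proof -
    have "integral\<^sup>L lborel ?g = integral\<^sup>L (distr lborel borel ((+) c)) ?g"
      by (simp add: lborel_distr_plus)
    also have "\<dots> = (\<integral>y. ?g (c + y) \<partial>lborel)"
    proof (rule integral_distr)
      have "(\<lambda>y. f (?p y)) \<in> borel_measurable ?B"
        by (rule measurable_compose[OF pm fm])
      then show "?g \<in> borel_measurable borel"
        by (subst (asm) borel_measurable_restrict_space_iff) (auto simp: mult.commute)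
    qed auto
    finally show ?thesis .
  qed
  also have "\<dots> = (\<integral>y. indicator (ball 0 r - {0}) y * f (c + (r / norm y) *\<^sub>R y) \<partial>lborel)"
    by (intro Bochner_Integration.integral_cong) (auto simp: indicator_def dist_norm)
  finally show ?thesis .
qed

text \<open>Such a map permutes the axes and reflects some of them, so preimages of boxes are boxes
  with the same side lengths up to order, and boxes determine Lebesgue measure. These symmetries
  suffice to compute the first and second moments of a sphere.\<close>

lemma lborel_distr_signed_permutation:
  fixes \<pi> :: "'a::euclidean_space \<Rightarrow> 'a" and s :: "'a \<Rightarrow> real"
  assumes \<pi>: "bij_betw \<pi> Basis Basis" and s: "\<And>b. b \<in> Basis \<Longrightarrow> \<bar>s b\<bar> = 1"
  shows "distr lborel borel (\<lambda>y. \<Sum>b\<in>Basis. (s b * (y \<bullet> \<pi> b)) *\<^sub>R b) = lborel" (is "distr _ _ ?T = _")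
proof -
  have "lborel = distr lborel borel ?T"
  proof (rule lborel_eqI)
    fix l u :: 'a
    assume le: "\<And>b. b \<in> Basis \<Longrightarrow> l \<bullet> b \<le> u \<bullet> b"
    define \<tau> where "\<tau> = inv_into Basis \<pi>"
    have \<tau>: "\<tau> (\<pi> b) = b" "\<pi> b \<in> Basis" if "b \<in> Basis" for b
      using \<pi> that by (auto simp: \<tau>_def bij_betw_def)
    have \<tau>': "\<pi> (\<tau> b) = b" "\<tau> b \<in> Basis" if "b \<in> Basis" for b
      using \<pi> that by (auto simp: \<tau>_def bij_betw_def f_inv_into_f inv_into_into)
    have s': "s b = 1 \<or> s b = -1" if "b \<in> Basis" for b
      using s[OF that] by linarith
    \<comment> \<open>Corners of the preimage box: the bounds on axis \<open>b\<close> come from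
      axis \<open>\<tau> b\<close>, and a reflected axis exchanges its two bounds and changes their
      signs.\<close>
    define l' where "l' = (\<Sum>b\<in>Basis. (if s (\<tau> b) = 1 then l \<bullet> \<tau> b else - (u \<bullet> \<tau> b)) *\<^sub>R b)"
    define u' where "u' = (\<Sum>b\<in>Basis. (if s (\<tau> b) = 1 then u \<bullet> \<tau> b else - (l \<bullet> \<tau> b)) *\<^sub>R b)"
    have T: "?T y \<bullet> b = s b * (y \<bullet> \<pi> b)" if "b \<in> Basis" for b y
      using that by simp
    have "?T -` box l u = box l' u'"
    proof (intro set_eqI)
      fix y
      have "y \<in> ?T -` box l u \<longleftrightarrow> (\<forall>b\<in>Basis. l \<bullet> b < s b * (y \<bullet> \<pi> b) \<and> s b * (y \<bullet> \<pi> b) < u \<bullet> b)"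
        by (simp add: mem_box)
      also have "\<dots> \<longleftrightarrow> (\<forall>b\<in>Basis. l' \<bullet> \<pi> b < y \<bullet> \<pi> b \<and> y \<bullet> \<pi> b < u' \<bullet> \<pi> b)"
      proof (intro ball_cong refl)
        fix b :: 'a assume b: "b \<in> Basis"
        show "l \<bullet> b < s b * (y \<bullet> \<pi> b) \<and> s b * (y \<bullet> \<pi> b) < u \<bullet> b \<longleftrightarrow>
          l' \<bullet> \<pi> b < y \<bullet> \<pi> b \<and> y \<bullet> \<pi> b < u' \<bullet> \<pi> b"
          using s'[OF b] \<tau>[OF b] by (auto simp: l'_def u'_def)
      qed
      also have "\<dots> \<longleftrightarrow> (\<forall>b\<in>Basis. l' \<bullet> b < y \<bullet> b \<and> y \<bullet> b < u' \<bullet> b)"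
        using bij_betw_imp_surj_on[OF \<pi>] by (metis (no_types, lifting) imageE imageI)
      finally show "y \<in> ?T -` box l u \<longleftrightarrow> y \<in> box l' u'"
        by (simp add: mem_box)
    qed
    then have "emeasure (distr lborel borel ?T) (box l u) = emeasure lborel (box l' u')"
      by (subst emeasure_distr) auto
    also have "\<dots> = ennreal (\<Prod>b\<in>Basis. (u' - l') \<bullet> b)"
    proof (rule emeasure_lborel_box)
      fix b :: 'a assume b: "b \<in> Basis"
      then show "l' \<bullet> b \<le> u' \<bullet> b"
        using le[OF \<tau>'(2)[OF b]] by (simp add: l'_def u'_def)
    qed
    also have "(\<Prod>b\<in>Basis. (u' - l') \<bullet> b) = (\<Prod>b\<in>Basis. (u - l) \<bullet> \<tau> b)"
      by (intro prod.cong refl) (simp add: l'_def u'_def inner_diff_left)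
    also have "\<dots> = (\<Prod>b\<in>Basis. (u - l) \<bullet> b)"
      using bij_betw_inv_into[OF \<pi>] unfolding \<tau>_def
      by (rule prod.reindex_bij_betw)
    finally show "emeasure (distr lborel borel ?T) (box l u) = ennreal (\<Prod>b\<in>Basis. (u - l) \<bullet> b)" .
  qed simp
  then show ?thesis by simp
qed

text \<open>\<open>T\<close> is a linear isometry, so it commutes with the radial projection and
  preserves the punctured ball; the invariance of Lebesgue measure then passes to the
  sphere.\<close>

lemma integral_sphere_signed_permutation:
  fixes f :: "'a::euclidean_space \<Rightarrow> real"
  assumes r: "r > 0" and \<pi>: "bij_betw \<pi> Basis Basis" and s: "\<And>b. b \<in> Basis \<Longrightarrow> \<bar>s b\<bar> = 1"
    and f: "continuous_on UNIV f"
  defines "T \<equiv> (\<lambda>y. \<Sum>b\<in>Basis. (s b * (y \<bullet> \<pi> b)) *\<^sub>R b)"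
  shows "(\<integral>y. f (T (y - c)) \<partial>sphere_measure c r) = (\<integral>y. f (y - c) \<partial>sphere_measure c r)"
proof -
  have linT: "linear T"
    unfolding T_def
    by (rule linearI) (simp_all add: inner_add_left algebra_simps sum.distrib scaleR_sum_right)
  have Tb: "T y \<bullet> b = s b * (y \<bullet> \<pi> b)" if "b \<in> Basis" for b y
    using that by (simp add: T_def)
  have "T y \<bullet> T y = y \<bullet> y" for y
  proof -
    have "T y \<bullet> T y = (\<Sum>b\<in>Basis. (T y \<bullet> b) * (T y \<bullet> b))"
      by (rule euclidean_inner)
    also have "\<dots> = (\<Sum>b\<in>Basis. (y \<bullet> \<pi> b) * (y \<bullet> \<pi> b))"
    proof (intro sum.cong refl)
      fix b :: 'a assume b: "b \<in> Basis"
      have "s b * s b = 1" using s[OF b] by (metis abs_mult_self_eq mult_1)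
      then show "(T y \<bullet> b) * (T y \<bullet> b) = (y \<bullet> \<pi> b) * (y \<bullet> \<pi> b)"
        using b by (simp add: Tb algebra_simps)
    qed
    also have "\<dots> = (\<Sum>b\<in>Basis. (y \<bullet> b) * (y \<bullet> b))"
      using \<pi> by (rule sum.reindex_bij_betw)
    also have "\<dots> = y \<bullet> y"
      by (rule euclidean_inner[symmetric])
    finally show ?thesis .
  qed
  then have normT: "norm (T y) = norm y" for y
    by (simp add: norm_eq_sqrt_inner)
  have contT: "continuous_on S T" for S
    using linT by (simp add: linear_continuous_on linear_conv_bounded_linear)
  note Tm = borel_measurable_continuous_onI[OF contT]
  let ?g = "\<lambda>y. indicator (ball 0 r - {0}) y * f ((r / norm y) *\<^sub>R y)"
  have fm: "f \<in> borel_measurable borel"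
    using f by (rule borel_measurable_continuous_onI)
  have cf: "continuous_on S (\<lambda>y. f (y - c))" for S
    by (intro continuous_on_compose2[OF f]) (auto intro!: continuous_intros)
  have cfT: "continuous_on S (\<lambda>y. f (T (y - c)))" for S
    by (intro continuous_on_compose2[OF f] continuous_on_compose2[OF contT[of UNIV]])
       (auto intro!: continuous_intros)
  have "(\<integral>y. f (T (y - c)) \<partial>sphere_measure c r) = real DIM('a) / r *
    (\<integral>y. indicator (ball 0 r - {0}) y * f (T ((r / norm y) *\<^sub>R y)) \<partial>lborel)"
    using integral_sphere_measure[OF r cfT] by simp
  also have "(\<integral>y. indicator (ball 0 r - {0}) y * f (T ((r / norm y) *\<^sub>R y)) \<partial>lborel) =
    (\<integral>y. ?g (T y) \<partial>lborel)"
  proof (intro Bochner_Integration.integral_cong refl)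
    fix y
    have "T y = 0 \<longleftrightarrow> y = 0" using normT by (metis norm_eq_zero)
    then show "indicator (ball 0 r - {0}) y * f (T ((r / norm y) *\<^sub>R y)) = ?g (T y)"
      by (simp add: normT linear_cmul[OF linT] indicator_def dist_norm)
  qed
  also have "\<dots> = (\<integral>y. ?g y \<partial>distr lborel borel T)"
    using Tm by (subst integral_distr)
      (auto intro!: borel_measurable_times borel_measurable_indicator measurable_compose[OF _ fm])
  also have "distr lborel borel T = lborel"
    unfolding T_def by (rule lborel_distr_signed_permutation) fact+
  also have "real DIM('a) / r * (\<integral>y. ?g y \<partial>lborel) = (\<integral>y. f (y - c) \<partial>sphere_measure c r)"
    using integral_sphere_measure[OF r cf] by simp
  finally show ?thesis .
qed

section \<open>Moments of the surface measure up to order two\<close>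

lemma sphere_first_moment:
  assumes r: "r > 0" and b: "b \<in> Basis"
  shows "(\<integral>y. (y - c) \<bullet> b \<partial>sphere_measure (c::'a::euclidean_space) r) = 0"
proof -
  have "(\<integral>y. (\<Sum>b\<in>Basis. (- 1 * ((y - c) \<bullet> id b)) *\<^sub>R b) \<bullet> b \<partial>sphere_measure c r) =
      (\<integral>y. (y - c) \<bullet> b \<partial>sphere_measure c r)"
    by (rule integral_sphere_signed_permutation)
      (use r bij_betw_id in \<open>auto simp: id_def intro!: continuous_intros\<close>)
  then show ?thesis
    unfolding inner_sum_left_Basis[OF b] by simp
qed

text \<open>Reflecting the single coordinate \<open>b\<close> changes the sign of the
  integrand.\<close>

lemma sphere_mixed_moment:
  assumes r: "r > 0" and bc: "b \<in> Basis" "d \<in> Basis" "b \<noteq> d"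
  shows "(\<integral>y. ((y - c) \<bullet> b) * ((y - c) \<bullet> d) \<partial>sphere_measure (c::'a::euclidean_space) r) = 0"
proof -
  let ?T = "\<lambda>y. \<Sum>e\<in>Basis. ((if e = b then -1 else 1) * (y \<bullet> id e)) *\<^sub>R e"
  have "(\<integral>y. (?T (y - c) \<bullet> b) * (?T (y - c) \<bullet> d) \<partial>sphere_measure c r) =
      (\<integral>y. ((y - c) \<bullet> b) * ((y - c) \<bullet> d) \<partial>sphere_measure c r)"
    by (rule integral_sphere_signed_permutation[where f = "\<lambda>y. (y \<bullet> b) * (y \<bullet> d)"])
       (use r bij_betw_id in \<open>auto simp: id_def intro!: continuous_intros\<close>)
  then show ?thesis
    using bc by simp
qed

text \<open>The symmetry used exchanges the axes \<open>b\<close> and \<open>d\<close>.\<close>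

lemma sphere_second_moment_eq:
  assumes r: "r > 0" and bd: "b \<in> Basis" "d \<in> Basis"
  shows "(\<integral>y. ((y - c) \<bullet> b)\<^sup>2 \<partial>sphere_measure (c::'a::euclidean_space) r) =
    (\<integral>y. ((y - c) \<bullet> d)\<^sup>2 \<partial>sphere_measure c r)"
proof -
  let ?\<pi> = "\<lambda>e. if e = b then d else if e = d then b else e"
  let ?T = "\<lambda>y. \<Sum>e\<in>Basis. (1 * (y \<bullet> ?\<pi> e)) *\<^sub>R e"
  have "bij_betw ?\<pi> Basis Basis"
    using bd by (intro bij_betw_byWitness[where f' = ?\<pi>]) (auto split: if_splits)
  then have "(\<integral>y. (?T (y - c) \<bullet> d)\<^sup>2 \<partial>sphere_measure c r) =
      (\<integral>y. ((y - c) \<bullet> d)\<^sup>2 \<partial>sphere_measure c r)"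
    by (rule integral_sphere_signed_permutation[OF r, where f = "\<lambda>y. (y \<bullet> d)\<^sup>2"])
       (auto intro!: continuous_intros)
  moreover have "?T y \<bullet> d = y \<bullet> b" for y
    using bd by simp
  ultimately show ?thesis
    by simp
qed

text \<open>The second moments along all axes agree, and their sum is the integral of |y - c|^2 =
  r^2.\<close>

lemma sphere_second_moment:
  assumes r: "r > 0" and b: "b \<in> Basis"
  shows "(\<integral>y. ((y - c) \<bullet> b)\<^sup>2 \<partial>sphere_measure (c::'a::euclidean_space) r) =
    r\<^sup>2 / DIM('a) * sphere_area DIM('a) r"
proof -
  let ?M = "sphere_measure c r"
  have "real DIM('a) * (\<integral>y. ((y - c) \<bullet> b)\<^sup>2 \<partial>?M) = (\<Sum>d\<in>Basis. \<integral>y. ((y - c) \<bullet> d)\<^sup>2 \<partial>?M)"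
    using sphere_second_moment_eq[OF r _ b, of _ c] by simp
  also have "\<dots> = (\<integral>y. (\<Sum>d\<in>Basis. ((y - c) \<bullet> d)\<^sup>2) \<partial>?M)"
    by (intro Bochner_Integration.integral_sum[symmetric] integrable_sphere_measure r)
       (auto intro!: continuous_intros)
  also have "\<dots> = (\<integral>y. r\<^sup>2 \<partial>?M)"
  proof (intro Bochner_Integration.integral_cong refl)
    fix y assume "y \<in> space ?M"
    then have "norm (y - c) = r" by (simp add: dist_norm norm_minus_commute)
    moreover have "(\<Sum>d\<in>Basis. ((y - c) \<bullet> d)\<^sup>2) = (norm (y - c))\<^sup>2"
      unfolding power2_norm_eq_inner euclidean_inner[of "y - c" "y - c"]
      by (simp add: power2_eq_square)
    ultimately show "(\<Sum>d\<in>Basis. ((y - c) \<bullet> d)\<^sup>2) = r\<^sup>2" by simp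
  qed
  also have "\<dots> = r\<^sup>2 * sphere_area DIM('a) r"
    using measure_sphere_measure[OF r, of c] by simp
  finally show ?thesis
    by (simp add: field_simps)
qed

definition sphere_mean :: "('a::euclidean_space \<Rightarrow> real) \<Rightarrow> 'a \<Rightarrow> real \<Rightarrow> real" where
  "sphere_mean f c r = 1 / sphere_area DIM('a) r * (\<integral>y. f y \<partial>sphere_measure c r)"

lemma sphere_mean_diff:
  assumes "r > 0" "continuous_on (sphere c r) f" "continuous_on (sphere c r) g"
  shows "sphere_mean (\<lambda>y. f y - g y) c r = sphere_mean f c r - sphere_mean g c r"
  using assms by (simp add: sphere_mean_def integrable_sphere_measure right_diff_distrib)

lemma sphere_mean_le:
  fixes f :: "'a::euclidean_space \<Rightarrow> real"
  assumes r: "r > 0" and "continuous_on (sphere c r) f" and "\<And>y. y \<in> sphere c r \<Longrightarrow> f y \<le> k"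
  shows "sphere_mean f c r \<le> k"
proof -
  have "(\<integral>y. f y \<partial>sphere_measure c r) \<le> (\<integral>y. k \<partial>sphere_measure c r)"
    using assms by (intro integral_mono integrable_sphere_measure) auto
  then show ?thesis
    using measure_sphere_measure[OF r, of c] sphere_area_pos[OF r, of "DIM('a)"]
    by (simp add: sphere_mean_def field_simps)
qed

text \<open>Integrate the second order Taylor expansion: the linear and mixed terms vanish by
  symmetry and each square contributes r^2 / m on average, so the mean differs from
  \<open>p x\<close> by r^2 / (2m) times the Laplacian, up to o(r^2).\<close>

lemma sphere_mean_laplacian:
  fixes p :: "'a::euclidean_space \<Rightarrow> real"
  assumes p: "real_polynomial_function p"
  shows "((\<lambda>r. 2 * real DIM('a) * (sphere_mean p x r - p x) / r\<^sup>2) \<longlongrightarrow> laplacian p x) (at_right 0)"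
proof (rule tendstoI)
  fix e :: real assume e: "e > 0"
  let ?m = "real DIM('a)"
  \<comment> \<open>The Taylor error is multiplied by 2m in the quotient and so becomes e /
    2.\<close>
  define e' where "e' = e / (4 * ?m)"
  have e': "e' > 0" using e by (simp add: e'_def)
  obtain d where d: "d > 0" and taylor: "\<And>h. norm h < d \<Longrightarrow>
    \<bar>p (x + h) - p x - (\<Sum>b\<in>Basis. (h \<bullet> b) * partial_deriv b p x) -
      (\<Sum>b\<in>Basis. \<Sum>c\<in>Basis. (h \<bullet> b) * (h \<bullet> c) * partial_deriv c (partial_deriv b p) x) / 2\<bar>
    \<le> e' * (norm h)\<^sup>2"
    using poly_taylor2[OF p e'] by blast
  have "dist (2 * ?m * (sphere_mean p x r - p x) / r\<^sup>2) (laplacian p x) < e"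
    if r: "0 < r" "r < d" for r
  proof -
    let ?M = "sphere_measure x r" and ?A = "sphere_area DIM('a) r"
    have A: "?A > 0" using r by (simp add: sphere_area_pos)
    define q where "q h = (\<Sum>b\<in>Basis. (h \<bullet> b) * partial_deriv b p x)" for h
    define Q where "Q h = (\<Sum>b\<in>Basis. \<Sum>c\<in>Basis. (h \<bullet> b) * (h \<bullet> c) *
      partial_deriv c (partial_deriv b p) x)" for h
    have cont: "continuous_on S (\<lambda>y. q (y - x))" "continuous_on S (\<lambda>y. Q (y - x))"
      "continuous_on S p" for S
      using p unfolding q_def Q_def by (intro continuous_intros poly_continuous_on; simp)+
    have int: "integrable ?M (\<lambda>y. q (y - x))" "integrable ?M (\<lambda>y. Q (y - x))" "integrable ?M p"
      "integrable ?M (\<lambda>y. p x)"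
      using r cont by (auto intro!: integrable_sphere_measure)
    have intm: "integrable ?M (\<lambda>y. k * ((y - x) \<bullet> b))"
      "integrable ?M (\<lambda>y. ((y - x) \<bullet> b) * ((y - x) \<bullet> c) * k)"
      "integrable ?M (\<lambda>y. ((y - x) \<bullet> b) * k)" "integrable ?M (\<lambda>y. (y - x) \<bullet> b)" for b c k
      using r by (auto intro!: integrable_sphere_measure continuous_intros)
    have 1: "(\<integral>y. q (y - x) \<partial>?M) = 0"
      unfolding q_def using r
      by (subst Bochner_Integration.integral_sum) (auto simp: intm sphere_first_moment)
    have 2: "(\<integral>y. Q (y - x) \<partial>?M) = r\<^sup>2 / ?m * ?A * laplacian p x"
    proof -
      have "(\<integral>y. ((y - x) \<bullet> b) * ((y - x) \<bullet> c) \<partial>?M) = (if c = b then r\<^sup>2 / ?m * ?A else 0)"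
        if "b \<in> Basis" "c \<in> Basis" for b c
        using that r sphere_mixed_moment[of r b c x] sphere_second_moment[of r b x]
        by (auto simp: power2_eq_square)
      note moment = this
      have "(\<integral>y. Q (y - x) \<partial>?M) = (\<Sum>b\<in>Basis. \<Sum>c\<in>Basis.
          (\<integral>y. ((y - x) \<bullet> b) * ((y - x) \<bullet> c) * partial_deriv c (partial_deriv b p) x \<partial>?M))"
        unfolding Q_def
        by (intro Bochner_Integration.integral_sum[THEN trans] Bochner_Integration.integrable_sum
            sum.cong refl intm)
      also have "\<dots> = (\<Sum>b\<in>Basis. \<Sum>c\<in>Basis.
          (if c = b then r\<^sup>2 / ?m * ?A else 0) * partial_deriv c (partial_deriv b p) x)"
        by (intro sum.cong refl) (simp only: integral_mult_left_zero moment)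
      also have "\<dots> = r\<^sup>2 / ?m * ?A * laplacian p x"
        by (simp add: laplacian_def sum_distrib_left if_distrib[of "\<lambda>x. x * _"] cong: if_cong)
      finally show ?thesis .
    qed
    have "\<bar>\<integral>y. (p y - p x - q (y - x) - Q (y - x) / 2) \<partial>?M\<bar> \<le>
        (\<integral>y. \<bar>p y - p x - q (y - x) - Q (y - x) / 2\<bar> \<partial>?M)"
      by (rule integral_abs_bound)
    also have "\<dots> \<le> (\<integral>y. e' * r\<^sup>2 \<partial>?M)"
    proof (intro integral_mono)
      fix y assume "y \<in> space ?M"
      then have "norm (y - x) = r" by (simp add: dist_norm norm_minus_commute)
      then show "\<bar>p y - p x - q (y - x) - Q (y - x) / 2\<bar> \<le> e' * r\<^sup>2"
        using taylor[of "y - x"] r by (simp add: q_def Q_def)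
    qed (use r cont in \<open>auto intro!: integrable_sphere_measure continuous_intros\<close>)
    also have "\<dots> = e' * r\<^sup>2 * ?A"
      using measure_sphere_measure[of r x] r by simp
    finally have "\<bar>\<integral>y. (p y - p x - q (y - x) - Q (y - x) / 2) \<partial>?M\<bar> \<le> e' * r\<^sup>2 * ?A" .
    moreover have "(\<integral>y. (p y - p x - q (y - x) - Q (y - x) / 2) \<partial>?M) =
       (\<integral>y. p y \<partial>?M) - ?A * p x - r\<^sup>2 / ?m * ?A * laplacian p x / 2"
      using int measure_sphere_measure[of r x] r by (simp add: 1 2)
    moreover have "\<dots> = ?A * r\<^sup>2 / (2 * ?m) * (2 * ?m * (sphere_mean p x r - p x) / r\<^sup>2 - laplacian p x)"
      using r A by (simp add: sphere_mean_def field_simps)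
    ultimately have "?A * r\<^sup>2 / (2 * ?m) * \<bar>2 * ?m * (sphere_mean p x r - p x) / r\<^sup>2 - laplacian p x\<bar>
        \<le> e' * r\<^sup>2 * ?A"
      using A r by (simp add: abs_mult)
    also have "\<dots> = ?A * r\<^sup>2 / (2 * ?m) * (e / 2)"
      by (simp add: e'_def field_simps)
    finally have "\<bar>2 * ?m * (sphere_mean p x r - p x) / r\<^sup>2 - laplacian p x\<bar> \<le> e / 2"
      using A r by (subst (asm) mult_le_cancel_left_pos) auto
    with e show ?thesis by (simp add: dist_real_def)
  qed
  then show "\<forall>\<^sub>F r in at_right 0. dist (2 * ?m * (sphere_mean p x r - p x) / r\<^sup>2) (laplacian p x) < e"
    using d by (auto simp: eventually_at_right_field)
qed

section \<open>A maximum principle\<close>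

text \<open>A Laplacian that presupposes no differentiability. It is split into an x part and a t
  part because the mean value identity concerns spheres in x alone. The second difference is the
  same expression in dimension one, where the sphere consists of two points.\<close>

definition mean_laplacian :: "('a::euclidean_space \<times> real \<Rightarrow> real) \<Rightarrow> 'a \<times> real \<Rightarrow> real \<Rightarrow> real" where
  "mean_laplacian f z r =
    2 * real DIM('a) * (sphere_mean (\<lambda>y. f (y, snd z)) (fst z) r - f z) / r\<^sup>2 +
    (f (fst z, snd z + r) + f (fst z, snd z - r) - 2 * f z) / r\<^sup>2"

lemma partial_deriv_fst: "partial_deriv (b, 0) f (x, t) = partial_deriv b (\<lambda>y. f (y, t)) x"
  by (simp add: partial_deriv_def)

lemma partial_deriv_snd: "partial_deriv (0, c) f (x, t) = partial_deriv c (\<lambda>s. f (x, s)) t"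
  by (simp add: partial_deriv_def)

lemma laplacian_prod:
  fixes f :: "'a::euclidean_space \<times> real \<Rightarrow> real"
  shows "laplacian f (x, t) = laplacian (\<lambda>y. f (y, t)) x + laplacian (\<lambda>s. f (x, s)) t"
proof -
  have "laplacian f (x, t) = (\<Sum>b\<in>(\<lambda>u. (u, 0)) ` Basis. partial_deriv b (partial_deriv b f) (x, t)) +
     (\<Sum>b\<in>(\<lambda>u. (0, u)) ` Basis. partial_deriv b (partial_deriv b f) (x, t))"
    unfolding laplacian_def Basis_prod_def by (rule sum.union_disjoint) auto
  also have "\<dots> = laplacian (\<lambda>y. f (y, t)) x + laplacian (\<lambda>s. f (x, s)) t"
    by (simp add: laplacian_def sum.reindex inj_on_def partial_deriv_fst partial_deriv_snd)
  finally show ?thesis .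
qed

lemma poly_section_fst:
  assumes "real_polynomial_function (p :: 'a::euclidean_space \<times> real \<Rightarrow> real)"
  shows "real_polynomial_function (\<lambda>y. p (y, t))"
proof -
  have "bounded_linear (\<lambda>y. (y, 0::real))"
    by (intro bounded_linear_Pair bounded_linear_ident bounded_linear_zero)
  then have "polynomial_function (\<lambda>y. (y, 0) + (0, t))"
    by (intro polynomial_function_add polynomial_function_bounded_linear polynomial_function_const)
  then show ?thesis
    using real_polynomial_function_compose[OF _ assms] by (simp add: o_def)
qed

lemma poly_section_snd:
  assumes "real_polynomial_function (p :: 'a::euclidean_space \<times> real \<Rightarrow> real)"
  shows "real_polynomial_function (\<lambda>s. p (x, s))"
proof -
  have "polynomial_function (\<lambda>s. s *\<^sub>R (0::'a, 1::real) + (x, 0))"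
    by (intro polynomial_function_add polynomial_function_bounded_linear polynomial_function_const
        bounded_linear_scaleR_left)
  then show ?thesis
    using real_polynomial_function_compose[OF _ assms] by (simp add: o_def)
qed

text \<open>Adding the Taylor expansions at r and -r cancels the first order terms.\<close>

lemma second_difference_laplacian:
  fixes p :: "real \<Rightarrow> real"
  assumes p: "real_polynomial_function p"
  shows "((\<lambda>r. (p (t + r) + p (t - r) - 2 * p t) / r\<^sup>2) \<longlongrightarrow> laplacian p t) (at_right 0)"
proof (rule tendstoI)
  fix e :: real assume e: "e > 0"
  obtain d where d: "d > 0" and *: "\<And>h. norm h < d \<Longrightarrow>
    \<bar>p (t + h) - p t - (\<Sum>b\<in>Basis. (h \<bullet> b) * partial_deriv b p t) -
      (\<Sum>b\<in>Basis. \<Sum>c\<in>Basis. (h \<bullet> b) * (h \<bullet> c) * partial_deriv c (partial_deriv b p) t) / 2\<bar>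
    \<le> e / 4 * (norm h)\<^sup>2"
    using poly_taylor2[OF p, of "e / 4"] e by auto
  have "dist ((p (t + r) + p (t - r) - 2 * p t) / r\<^sup>2) (laplacian p t) < e" if "0 < r" "r < d" for r
  proof -
    have "\<bar>p (t + r) + p (t - r) - 2 * p t - r\<^sup>2 * laplacian p t\<bar> \<le> e / 2 * r\<^sup>2"
    proof -
      have "\<bar>p (t + r) - p t - r * partial_deriv 1 p t - r\<^sup>2 * laplacian p t / 2\<bar> \<le> e / 4 * r\<^sup>2"
        "\<bar>p (t - r) - p t + r * partial_deriv 1 p t - r\<^sup>2 * laplacian p t / 2\<bar> \<le> e / 4 * r\<^sup>2"
        using *[of r] *[of "- r"] that by (simp_all add: laplacian_def power2_eq_square)
      then show ?thesis by linarith
    qed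
    also have "p (t + r) + p (t - r) - 2 * p t - r\<^sup>2 * laplacian p t =
        r\<^sup>2 * ((p (t + r) + p (t - r) - 2 * p t) / r\<^sup>2 - laplacian p t)"
      using that unfolding right_diff_distrib[of "r\<^sup>2" "_ / _"] by simp
    finally have "r\<^sup>2 * \<bar>(p (t + r) + p (t - r) - 2 * p t) / r\<^sup>2 - laplacian p t\<bar> \<le> r\<^sup>2 * (e / 2)"
      by (simp add: abs_mult mult.commute)
    then show ?thesis
      using that e by (subst (asm) mult_le_cancel_left_pos) (auto simp: dist_real_def)
  qed
  then show "\<forall>\<^sub>F r in at_right 0. dist ((p (t + r) + p (t - r) - 2 * p t) / r\<^sup>2) (laplacian p t) < e"
    using d by (auto simp: eventually_at_right_field)
qed

lemma mean_laplacian_poly: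
  fixes p :: "'a::euclidean_space \<times> real \<Rightarrow> real"
  assumes p: "real_polynomial_function p"
  shows "(mean_laplacian p z \<longlongrightarrow> laplacian p z) (at_right 0)"
  using tendsto_add[OF sphere_mean_laplacian[OF poly_section_fst[OF p, of "snd z"], of "fst z"]
      second_difference_laplacian[OF poly_section_snd[OF p, of "fst z"], of "snd z"]]
  by (simp add: mean_laplacian_def[abs_def] laplacian_prod[of p "fst z" "snd z", simplified])

text \<open>If the inequality failed, \<open>U - V\<close> would have a maximum at an interior point
  \<open>w\<close>. There spherical means and second differences of \<open>U - V\<close> do not
  exceed its value, so its mean Laplacian is nonpositive for all small r; the limit gives a
  nonnegative Laplacian of \<open>V\<close> at \<open>w\<close>, against strictness.\<close>

lemma maximum_principle:
  fixes U V :: "'a::euclidean_space \<times> real \<Rightarrow> real"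
  assumes R: "R > 0" and U: "continuous_on (cball z0 R) U"
    and LU: "\<And>z. z \<in> ball z0 R \<Longrightarrow> (mean_laplacian U z \<longlongrightarrow> 0) (at_right 0)"
    and V: "real_polynomial_function V"
    and LV: "\<And>z. z \<in> ball z0 R \<Longrightarrow> laplacian V z < 0"
    and le: "\<And>z. z \<in> sphere z0 R \<Longrightarrow> U z \<le> V z"
    and z: "z \<in> cball z0 R"
  shows "U z \<le> V z"
proof (rule ccontr)
  assume neg: "\<not> U z \<le> V z"
  have Vc: "continuous_on S V" for S
    using V by (rule poly_continuous_on)
  have "continuous_on (cball z0 R) (\<lambda>z. U z - V z)"
    by (intro continuous_intros U Vc)
  then have "\<exists>w\<in>cball z0 R. \<forall>y\<in>cball z0 R. U y - V y \<le> U w - V w"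
    using R by (intro continuous_attains_sup) auto
  then obtain w where w: "w \<in> cball z0 R"
    and max: "\<And>y. y \<in> cball z0 R \<Longrightarrow> U y - V y \<le> U w - V w"
    by blast
  have "w \<notin> sphere z0 R"
    using le[of w] max[OF z] neg by auto
  with w have wb: "w \<in> ball z0 R"
    by auto
  obtain x t where xt: "w = (x, t)" by (cases w)
  obtain d where d: "d > 0" "ball w d \<subseteq> ball z0 R"
    using wb open_ball by (metis open_contains_ball)
  have "mean_laplacian U w r - mean_laplacian V w r \<le> 0" if r: "0 < r" "r < d" for r
  proof -
    let ?f = "\<lambda>z. U z - V z"
    have in0: "v \<in> cball z0 R" if "dist w v < d" for v
      using that d(2) by (simp add: subset_iff less_imp_le del: split_paired_All)
    have in1: "(y, t) \<in> cball z0 R" if "y \<in> sphere x r" for y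
      using that r by (intro in0) (simp add: xt dist_Pair_Pair)
    have in2: "(x, t + r) \<in> cball z0 R" "(x, t - r) \<in> cball z0 R"
      using r by (intro in0; simp add: xt dist_Pair_Pair dist_real_def)+
    have c: "continuous_on (sphere x r) (\<lambda>y. U (y, t))" "continuous_on (sphere x r) (\<lambda>y. V (y, t))"
      using in1 by (auto intro!: continuous_on_compose2[OF U] continuous_on_compose2[OF Vc[of UNIV]]
          continuous_intros)
    have "sphere_mean (\<lambda>y. ?f (y, t)) x r \<le> ?f w"
      using max[OF in1] c by (intro sphere_mean_le r continuous_intros) auto
    then have "sphere_mean (\<lambda>y. U (y, t)) x r - sphere_mean (\<lambda>y. V (y, t)) x r \<le> ?f w"
      using sphere_mean_diff[OF r(1) c] by simp
    then have "2 * real DIM('a) * (sphere_mean (\<lambda>y. U (y, t)) x r -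
      sphere_mean (\<lambda>y. V (y, t)) x r - ?f w) / r\<^sup>2 \<le> 0"
      by (simp add: divide_le_0_iff mult_le_0_iff)
    moreover have "(?f (x, t + r) + ?f (x, t - r) - 2 * ?f w) / r\<^sup>2 \<le> 0"
      using max[OF in2(1)] max[OF in2(2)] by (simp add: divide_le_0_iff)
    ultimately show ?thesis
      unfolding mean_laplacian_def xt
      by (simp add: diff_divide_distrib add_divide_distrib algebra_simps)
  qed
  then have "\<forall>\<^sub>F r in at_right 0. mean_laplacian U w r - mean_laplacian V w r \<le> 0"
    using d by (auto simp: eventually_at_right_field)
  moreover have "((\<lambda>r. mean_laplacian U w r - mean_laplacian V w r) \<longlongrightarrow> 0 - laplacian V w) (at_right 0)"
    by (intro tendsto_diff LU wb mean_laplacian_poly V)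
  ultimately have "0 - laplacian V w \<le> 0"
    by (intro tendsto_upperbound) auto
  with LV[OF wb] show False by simp
qed

text \<open>Admits the zero function as \<open>U\<close>: a polynomial with nonpositive Laplacian is
  then nonnegative in the ball once it is so on the sphere.\<close>

lemma mean_laplacian_zero: "(mean_laplacian (\<lambda>_. 0) z \<longlongrightarrow> 0) F"
  by (simp add: mean_laplacian_def[abs_def] sphere_mean_def)

lemma mean_laplacian_uminus: "mean_laplacian (\<lambda>z. - f z) z r = - mean_laplacian f z r"
  by (simp add: mean_laplacian_def sphere_mean_def diff_divide_distrib add_divide_distrib
      algebra_simps)

text \<open>Adding a small multiple of \<open>sphere_poly z0 R\<close> to \<open>V\<close> makes the
  Laplacian strictly negative without changing the boundary values. The multiple
  \<open>e / R^2\<close> keeps the correction below \<open>e\<close> inside.\<close>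

lemma maximum_principle_weak:
  fixes U V :: "'a::euclidean_space \<times> real \<Rightarrow> real"
  assumes R: "R > 0" and U: "continuous_on (cball z0 R) U"
    and LU: "\<And>z. z \<in> ball z0 R \<Longrightarrow> (mean_laplacian U z \<longlongrightarrow> 0) (at_right 0)"
    and V: "real_polynomial_function V"
    and LV: "\<And>z. z \<in> ball z0 R \<Longrightarrow> laplacian V z \<le> 0"
    and le: "\<And>z. z \<in> sphere z0 R \<Longrightarrow> U z \<le> V z"
    and z: "z \<in> cball z0 R"
  shows "U z \<le> V z"
proof (rule field_le_epsilon)
  fix e :: real assume e: "e > 0"
  define k where "k = e / R\<^sup>2"
  have k: "k > 0" using e R by (simp add: k_def)
  let ?V = "\<lambda>z. V z + k * sphere_poly z0 R z"
  have "U z \<le> ?V z"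
  proof (rule maximum_principle[OF R U LU])
    show "real_polynomial_function ?V"
      by (intro poly_intros V poly_sphere_poly)
    show "laplacian ?V z < 0" if "z \<in> ball z0 R" for z
    proof -
      have "0 < k * real DIM('a \<times> real)"
        by (intro mult_pos_pos k) (simp only: of_nat_0_less_iff DIM_positive)
      moreover have "laplacian ?V z = laplacian V z - 2 * (k * real DIM('a \<times> real))"
        by (simp add: laplacian_add laplacian_cmult V poly_sphere_poly poly_mult poly_const
            laplacian_sphere_poly algebra_simps del: DIM_prod)
      ultimately show ?thesis
        using LV[OF that] by linarith
    qed
    show "U z \<le> ?V z" if "z \<in> sphere z0 R" for z
      using le[OF that] that by (simp add: sphere_poly_def dist_norm norm_minus_commute)
  qed (use z in auto)
  also have "\<dots> \<le> V z + e"
  proof -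
    have "k * sphere_poly z0 R z \<le> k * R\<^sup>2"
      using k by (intro mult_left_mono) (auto simp: sphere_poly_def)
    then show ?thesis using R by (simp add: k_def)
  qed
  finally show "U z \<le> V z + e" .
qed

section \<open>The Dirichlet problem with polynomial data\<close>

text \<open>\<open>T\<close> is linear on the span only: the intended operator is built from
  \<open>deriv\<close> and is not additive on arbitrary functions. The proof is a dimension count
  for the image of a basis.\<close>

lemma (in vector_space) inj_imp_surj_on_span:
  assumes S: "finite S" and TV: "\<And>v. v \<in> span S \<Longrightarrow> T v \<in> span S"
    and add: "\<And>v w. v \<in> span S \<Longrightarrow> w \<in> span S \<Longrightarrow> T (v + w) = T v + T w"
    and scale: "\<And>c v. v \<in> span S \<Longrightarrow> T (scale c v) = scale c (T v)"
    and inj: "\<And>v. v \<in> span S \<Longrightarrow> T v = 0 \<Longrightarrow> v = 0"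
    and w: "w \<in> span S"
  shows "\<exists>v\<in>span S. T v = w"
proof -
  obtain B where B: "B \<subseteq> span S" "independent B" "span S \<subseteq> span B"
    using maximal_independent_subset by blast
  have finB: "finite B"
    using independent_span_bound[OF S B(2,1)] by simp
  have spanB: "span B = span S"
    using B by (metis span_minimal subspace_span subset_antisym)
  have T0: "T 0 = 0"
    using scale[of 0 0] by (simp add: span_zero)
  have T_sum: "T (\<Sum>v\<in>A. scale (c v) v) = (\<Sum>v\<in>A. scale (c v) (T v))" if "finite A" "A \<subseteq> B" for A c
    using that
  proof (induction A rule: finite_induct)
    case (insert v A)
    have "scale (c v) v \<in> span S" "(\<Sum>v\<in>A. scale (c v) v) \<in> span S" "v \<in> span S"
      using insert B(1) by (auto intro!: span_scale span_sum)
    with insert show ?case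
      by (simp add: add scale)
  qed (simp add: T0)
  have injB: "inj_on T B"
  proof (rule inj_onI)
    fix v u assume *: "v \<in> B" "u \<in> B" "T v = T u"
    then have vu: "v \<in> span S" "u \<in> span S"
      using B(1) by auto
    \<comment> \<open>The difference is written as a sum because additivity and scaling are all that
      is known of \<open>T\<close>.\<close>
    then have "T (v + scale (-1) u) = T v + scale (-1) (T u)"
      unfolding scale[OF vu(2), symmetric] by (intro add span_scale vu)
    then have "T (v + scale (-1) u) = 0"
      using * by simp
    then have "v + scale (-1) u = 0"
      by (rule inj[OF span_add[OF vu(1) span_scale[OF vu(2)]]])
    then show "v = u" by simp
  qed
  have indep: "independent (T ` B)"
  proof
    assume "dependent (T ` B)"
    then obtain c where c: "\<exists>v\<in>B. c (T v) \<noteq> 0" and sum: "(\<Sum>v\<in>T ` B. scale (c v) v) = 0"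
      using finB by (auto simp: dependent_finite)
    have "T (\<Sum>v\<in>B. scale (c (T v)) v) = 0"
      using sum injB finB by (simp add: T_sum sum.reindex)
    moreover have "(\<Sum>v\<in>B. scale (c (T v)) v) \<in> span S"
      using B(1) by (intro span_sum span_scale) auto
    ultimately have "(\<Sum>v\<in>B. scale (c (T v)) v) = 0"
      using inj by blast
    with c B(2) finB show False
      by (auto simp: dependent_finite)
  qed
  \<comment> \<open>Otherwise \<open>w\<close> together with the image of \<open>B\<close> would be
    an independent set with one element more than \<open>B\<close> inside the span of
    \<open>B\<close>.\<close>
  have "w \<in> span (T ` B)"
  proof (rule ccontr)
    assume w': "w \<notin> span (T ` B)"
    then have "independent (insert w (T ` B))"
      using indep by (rule independent_insertI)
    moreover have "insert w (T ` B) \<subseteq> span B"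
      using w B(1) TV spanB by auto
    ultimately have "card (insert w (T ` B)) \<le> card B"
      using independent_span_bound[OF finB] by blast
    moreover have "w \<notin> T ` B"
      using w' span_base by blast
    ultimately show False
      using finB card_image[OF injB] by simp
  qed
  then obtain c where "w = (\<Sum>v\<in>T ` B. scale (c v) v)"
    using finB by (auto simp: span_finite)
  then have "w = T (\<Sum>v\<in>B. scale (c (T v)) v)"
    using finB injB by (simp add: T_sum sum.reindex)
  moreover have "(\<Sum>v\<in>B. scale (c (T v)) v) \<in> span S"
    using B(1) by (intro span_sum span_scale) auto
  ultimately show ?thesis by blast
qed

section \<open>Polynomials of bounded degree as finite-dimensional spaces\<close>

interpretation fun_space: vector_space "\<lambda>(c::real) (f::'b \<Rightarrow> real) x. c * f x"
  by unfold_locales (auto simp: fun_eq_iff algebra_simps)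

text \<open>All products of at most \<open>k\<close> coordinate functions, formed one factor at a
  time; finiteness of this spanning set is what the dimension count needs.\<close>

fun monomials :: "nat \<Rightarrow> ('b::euclidean_space \<Rightarrow> real) set" where
  "monomials 0 = {\<lambda>x. 1}"
| "monomials (Suc k) = monomials k \<union> (\<Union>b\<in>Basis. (\<lambda>f x. (x \<bullet> b) * f x) ` monomials k)"

definition polys :: "nat \<Rightarrow> ('b::euclidean_space \<Rightarrow> real) set" where
  "polys k = fun_space.span (monomials k)"

lemma finite_monomials: "finite (monomials k)"
  by (induction k) auto

lemma polys_add: "f \<in> polys k \<Longrightarrow> g \<in> polys k \<Longrightarrow> (\<lambda>x. f x + g x) \<in> polys k"
  using fun_space.span_add[of f _ g] by (simp add: polys_def plus_fun_def)

lemma polys_scale: "f \<in> polys k \<Longrightarrow> (\<lambda>x. c * f x) \<in> polys k"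
  using fun_space.span_scale[of f _ c] by (simp add: polys_def)

lemma polys_zero: "(\<lambda>x. 0) \<in> polys k"
  using fun_space.span_zero by (simp add: polys_def zero_fun_def)

lemma polys_diff: "f \<in> polys k \<Longrightarrow> g \<in> polys k \<Longrightarrow> (\<lambda>x. f x - g x) \<in> polys k"
  using polys_add[OF _ polys_scale[of g k "-1"], of f] by simp

lemma polys_sum:
  "(\<And>i. i \<in> I \<Longrightarrow> f i \<in> polys k) \<Longrightarrow> (\<lambda>x. \<Sum>i\<in>I. f i x) \<in> polys k"
  by (induction I rule: infinite_finite_induct) (simp_all add: polys_zero polys_add)

text \<open>Besides the induction hypotheses, the cases provide membership in
  \<open>polys k\<close>: the rules for derivatives of sums and multiples hold only for functions
  known to be polynomials.\<close>

lemma polys_induct [consumes 1, case_names monomial zero add scale]: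
  assumes "f \<in> polys k" and "\<And>f. f \<in> monomials k \<Longrightarrow> P f" and "P (\<lambda>x. 0)"
    and "\<And>f g. f \<in> polys k \<Longrightarrow> g \<in> polys k \<Longrightarrow> P f \<Longrightarrow> P g \<Longrightarrow> P (\<lambda>x. f x + g x)"
    and "\<And>c f. f \<in> polys k \<Longrightarrow> P f \<Longrightarrow> P (\<lambda>x. c * f x)"
  shows "P f"
proof -
  have "f \<in> polys k \<and> P f"
    using assms(1) unfolding polys_def
  proof (induction rule: fun_space.span_induct)
    case base
    show ?case
      unfolding fun_space.subspace_def
      using assms(3-5) polys_zero polys_add polys_scale
      by (auto simp: zero_fun_def plus_fun_def polys_def)
  next
    case (step f)
    then show ?case
      using assms(2) fun_space.span_base by auto
  qed
  then show ?thesis ..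
qed

lemma polys_Suc: "f \<in> polys k \<Longrightarrow> f \<in> polys (Suc k)"
  unfolding polys_def using fun_space.span_mono[of "monomials k" "monomials (Suc k)"] by auto

lemma polys_mono: "f \<in> polys k \<Longrightarrow> k \<le> l \<Longrightarrow> f \<in> polys l"
  by (rule dec_induct[of k l "\<lambda>l. f \<in> polys l"]) (auto intro: polys_Suc)

lemma polys_inner_Basis_mult:
  assumes "f \<in> polys k" "b \<in> Basis"
  shows "(\<lambda>x. (x \<bullet> b) * f x) \<in> polys (Suc k)"
  using assms(1)
proof (induction rule: polys_induct)
  case (monomial f)
  with assms(2) have "(\<lambda>x. (x \<bullet> b) * f x) \<in> monomials (Suc k)"
    by auto
  then show ?case unfolding polys_def by (rule fun_space.span_base)
next
  case (add f g)
  with polys_add[OF this(3,4)] show ?case by (simp add: algebra_simps)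
next
  case (scale c f)
  with polys_scale[OF this(2), of c] show ?case by (simp add: algebra_simps)
qed (simp add: polys_zero)

lemma polys_imp_poly: "f \<in> polys k \<Longrightarrow> real_polynomial_function f"
proof (induction rule: polys_induct)
  case (monomial f)
  then show ?case
    by (induction k arbitrary: f) (auto intro: poly_intros)
qed (auto intro: poly_intros)

lemma polys_const: "(\<lambda>x. c) \<in> polys 0"
  using polys_scale[of "\<lambda>x. 1" 0 c] by (simp add: polys_def fun_space.span_base)

text \<open>The truncated \<open>k - 1\<close> is correct at \<open>k = 0\<close>, where the
  derivative is zero.\<close>

lemma partial_deriv_polys:
  assumes "f \<in> polys k" "b \<in> Basis"
  shows "partial_deriv b f \<in> polys (k - 1)"
  using assms(1)
proof (induction rule: polys_induct)
  case (monomial f)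
  then show ?case
  proof (induction k arbitrary: f)
    case 0
    then show ?case by (simp add: polys_zero)
  next
    case (Suc k)
    consider "f \<in> monomials k" | c g where "c \<in> Basis" "g \<in> monomials k" "f = (\<lambda>x. (x \<bullet> c) * g x)"
      using Suc.prems by auto
    then show ?case
    proof cases
      case 1
      then show ?thesis using Suc.IH polys_mono by force
    next
      case 2
      have g: "g \<in> polys k"
        using 2 by (simp add: polys_def fun_space.span_base)
      have "(\<lambda>x. (x \<bullet> c) * partial_deriv b g x) \<in> polys k"
      \<comment> \<open>Multiplication by a coordinate leads from \<open>k - 1\<close> back to
        \<open>k\<close> only for positive \<open>k\<close>; for \<open>k = 0\<close> the derivative
        of \<open>g\<close> vanishes.\<close>
      proof (cases k)
        case 0
        with 2 show ?thesis by (simp add: polys_zero)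
      next
        case (Suc j)
        with Suc.IH[OF 2(2)] 2(1) show ?thesis using polys_inner_Basis_mult by force
      qed
      from polys_add[OF this polys_scale[OF g, of "b \<bullet> c"]] show ?thesis
        using polys_imp_poly[OF g] by (simp add: 2(3) partial_deriv_mult poly_inner)
    qed
  qed
next
  case (add f g)
  with polys_add[OF this(3,4)] show ?case by (simp add: partial_deriv_add polys_imp_poly)
next
  case (scale c f)
  with polys_scale[OF this(2), of c] show ?case by (simp add: partial_deriv_cmult polys_imp_poly)
qed (simp add: polys_zero)

lemma polys_mult:
  assumes "f \<in> polys j" and g: "g \<in> polys k"
  shows "(\<lambda>x. f x * g x) \<in> polys (j + k)"
  using assms(1)
proof (induction rule: polys_induct)
  case (monomial f)
  then show ?case
  proof (induction j arbitrary: f)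
    case 0
    then show ?case using g by simp
  next
    case (Suc j)
    then consider "f \<in> monomials j" | c h where "c \<in> Basis" "h \<in> monomials j" "f = (\<lambda>x. (x \<bullet> c) * h x)"
      by auto
    then show ?case
    proof cases
      case 1
      with polys_Suc[OF Suc.IH] show ?thesis by simp
    next
      case 2
      with polys_inner_Basis_mult[OF Suc.IH[OF 2(2)] 2(1)] show ?thesis
        by (simp add: mult.assoc)
    qed
  qed
next
  case (add f g')
  with polys_add[OF this(3,4)] show ?case by (simp add: algebra_simps)
next
  case (scale c f)
  with polys_scale[OF this(2), of c] show ?case by (simp add: algebra_simps)
qed (simp add: polys_zero)

lemma polys_inner: "(\<lambda>x. x \<bullet> (c::'b::euclidean_space)) \<in> polys 1"
proof -
  have "(\<lambda>x. \<Sum>b\<in>Basis. (c \<bullet> b) * ((x \<bullet> b) * 1)) \<in> polys 1"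
    using polys_inner_Basis_mult[OF polys_const] unfolding One_nat_def
    by (intro polys_sum polys_scale)
  moreover have "x \<bullet> c = (\<Sum>b\<in>Basis. (c \<bullet> b) * ((x \<bullet> b) * 1))" for x
    by (simp add: euclidean_inner[of x c] mult.commute)
  ultimately show ?thesis by simp
qed

lemma poly_imp_polys:
  fixes f :: "'b::euclidean_space \<Rightarrow> real"
  assumes "real_polynomial_function f"
  shows "\<exists>k. f \<in> polys k"
  using assms
proof (induction f rule: real_polynomial_function.induct)
  case (linear f)
  have "f x = x \<bullet> (\<Sum>b\<in>Basis. f b *\<^sub>R b)" for x
  proof -
    have "f x = f (\<Sum>b\<in>Basis. (x \<bullet> b) *\<^sub>R b)"
      by (simp add: euclidean_representation)
    also have "\<dots> = x \<bullet> (\<Sum>b\<in>Basis. f b *\<^sub>R b)"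
      using bounded_linear.linear[OF linear]
      by (simp add: linear_sum linear_cmul inner_sum_right mult.commute)
    finally show ?thesis .
  qed
  then have "f = (\<lambda>x. x \<bullet> (\<Sum>b\<in>Basis. f b *\<^sub>R b))" ..
  then show ?case using polys_inner by metis
next
  case (const c)
  then show ?case using polys_const by blast
next
  case (add f g)
  then obtain i j where "f \<in> polys i" "g \<in> polys j" by blast
  then have "f \<in> polys (max i j)" "g \<in> polys (max i j)"
    by (auto intro: polys_mono)
  then show ?case using polys_add by blast
next
  case (mult f g)
  then show ?case using polys_mult by blast
qed

lemma sphere_poly_polys: "sphere_poly (z0::'b::euclidean_space) R \<in> polys 2"
proof -
  have "(\<lambda>z. (R\<^sup>2 - z0 \<bullet> z0) - ((\<Sum>b\<in>Basis. (z \<bullet> b) * (z \<bullet> b)) - 2 * (z \<bullet> z0))) \<in> polys 2"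
  proof (intro polys_diff polys_sum polys_scale)
    show "(\<lambda>z. (z \<bullet> b) * (z \<bullet> b)) \<in> polys 2" for b
      using polys_mult[OF polys_inner polys_inner, of b b] by (simp add: numeral_2_eq_2)
  qed (auto intro: polys_mono polys_const polys_inner)
  then show ?thesis by (simp add: sphere_poly_altdef)
qed

lemma laplacian_polys:
  assumes "f \<in> polys (k + 2)"
  shows "laplacian f \<in> polys k"
proof -
  have "partial_deriv b (partial_deriv b f) \<in> polys k" if "b \<in> Basis" for b
    using partial_deriv_polys[OF partial_deriv_polys[OF assms that] that] by simp
  then show ?thesis
    unfolding laplacian_def[abs_def] by (rule polys_sum)
qed

text \<open>On the line through \<open>z0\<close> and \<open>z\<close> the polynomial depends on one
  variable and has infinitely many zeros near \<open>z0\<close>, so all its coefficients vanish;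
  parameter 1 gives the value at \<open>z\<close>.\<close>

lemma poly_zero_on_ball:
  fixes q :: "'b::euclidean_space \<Rightarrow> real"
  assumes q: "real_polynomial_function q" and R: "R > 0" and 0: "\<And>z. z \<in> ball z0 R \<Longrightarrow> q z = 0"
  shows "q z = 0"
proof -
  have "polynomial_function (\<lambda>s. s *\<^sub>R (z - z0) + z0)"
    by (intro polynomial_function_add polynomial_function_bounded_linear polynomial_function_const
        bounded_linear_scaleR_left)
  from real_polynomial_function_compose[OF this q]
  obtain a n where a: "\<And>s. q (s *\<^sub>R (z - z0) + z0) = (\<Sum>i\<le>n. a i * s ^ i)"
    unfolding real_polynomial_function_iff_sum by (auto simp: fun_eq_iff)
  \<comment> \<open>Positive parameters below \<open>d\<close> stay in the ball; the summand 1
    covers the case \<open>z = z0\<close>.\<close>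
  define d where "d = R / (norm (z - z0) + 1)"
  have d: "d > 0"
    using R by (simp add: d_def add_nonneg_pos)
  have "(\<Sum>i\<le>n. a i * s ^ i) = 0" if "s \<in> {0<..<d}" for s
  proof -
    have "s * norm (z - z0) \<le> s * (norm (z - z0) + 1)"
      using that by (intro mult_left_mono) auto
    also have "\<dots> < R"
      using that R unfolding d_def by (simp add: add_nonneg_pos pos_less_divide_eq)
    finally show ?thesis
      using that a[of s] by (subst a[symmetric], intro 0) (simp add: dist_norm)
  qed
  then have "{0<..<d} \<subseteq> {s. (\<Sum>i\<le>n. a i * s ^ i) = 0}"
    by blast
  then have "infinite {s. (\<Sum>i\<le>n. a i * s ^ i) = 0}"
    using infinite_Ioo[OF d] finite_subset by blast
  then have "\<forall>i\<le>n. a i = 0"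
    using polyfun_roots_finite[of a _ n] by blast
  with a[of 1] show ?thesis by simp
qed

text \<open>Compare the zero function with \<open>p\<close> and with its negative.\<close>

lemma harmonic_poly_zero:
  fixes p :: "'a::euclidean_space \<times> real \<Rightarrow> real"
  assumes R: "R > 0" and p: "real_polynomial_function p"
    and harm: "\<And>z. z \<in> ball z0 R \<Longrightarrow> laplacian p z = 0"
    and bdry: "\<And>z. z \<in> sphere z0 R \<Longrightarrow> p z = 0"
    and z: "z \<in> cball z0 R"
  shows "p z = 0"
proof (rule antisym)
  have "0 \<le> p z"
    by (rule maximum_principle_weak[OF R continuous_on_const mean_laplacian_zero p]) (use harm bdry z in auto)
  then show "0 \<le> p z" .
  have "real_polynomial_function (\<lambda>z. - 1 * p z)"
    by (intro poly_intros p)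
  then have "0 \<le> - 1 * p z"
    by (rule maximum_principle_weak[OF R continuous_on_const mean_laplacian_zero])
      (use harm bdry z in \<open>auto simp: laplacian_cmult[OF p, of "-1", simplified]\<close>)
  then show "p z \<le> 0" by simp
qed

text \<open>Put V = p - w q with w = \<open>sphere_poly z0 R\<close>: the boundary values are right
  for every q, and it remains to choose q so that w q and p have the same Laplacian. Multiplication
  by w raises the degree by two and the Laplacian lowers it by two. Injectivity is uniqueness in the
  Dirichlet problem, since w q vanishes on the sphere.\<close>

lemma dirichlet_poly:
  fixes p :: "'a::euclidean_space \<times> real \<Rightarrow> real"
  assumes R: "R > 0" and p: "real_polynomial_function p"
  obtains V where "real_polynomial_function V" "laplacian V = (\<lambda>z. 0)"
    "\<And>z. z \<in> sphere z0 R \<Longrightarrow> V z = p z"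
proof -
  let ?w = "sphere_poly z0 R"
  define T where "T q = laplacian (\<lambda>z. ?w z * q z)" for q
  obtain k where k: "laplacian p \<in> polys k"
    using poly_imp_polys[OF poly_laplacian[OF p]] by blast
  have mult: "real_polynomial_function (\<lambda>z. ?w z * q z)" if "q \<in> polys k" for q
    using that by (intro poly_intros poly_sphere_poly polys_imp_poly)
  have "\<exists>q\<in>fun_space.span (monomials k). T q = laplacian p"
  proof (rule fun_space.inj_imp_surj_on_span[OF finite_monomials]; fold polys_def)
    show "laplacian p \<in> polys k" by (rule k)
    show "T v \<in> polys k" if "v \<in> polys k" for v
      unfolding T_def
      using polys_mult[OF sphere_poly_polys that] by (intro laplacian_polys) (simp add: add.commute)
    show "T (v + w) = T v + T w" if "v \<in> polys k" "w \<in> polys k" for v w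
      using laplacian_add[OF mult[OF that(1)] mult[OF that(2)]]
      by (simp add: T_def distrib_left plus_fun_def)
    show "T (\<lambda>x. c * v x) = (\<lambda>x. c * T v x)" if "v \<in> polys k" for c v
      using laplacian_cmult[OF mult[OF that], of c] by (simp add: T_def algebra_simps)
    show "v = 0" if v: "v \<in> polys k" and "T v = 0" for v
    proof
      fix z
      \<comment> \<open>The factor \<open>sphere_poly z0 R\<close> can be cancelled inside the ball,
        where it is positive; the identity theorem for polynomials extends the result to all
        points.\<close>
      have "v z = 0" if "z \<in> ball z0 R" for z
      proof -
        have "?w z * v z = 0"
        proof (rule harmonic_poly_zero[OF R mult[OF v]])
          show "laplacian (\<lambda>z. ?w z * v z) y = 0" for y
            using \<open>T v = 0\<close> by (metis T_def zero_fun_apply)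
          show "?w y * v y = 0" if "y \<in> sphere z0 R" for y
            using that by (simp add: sphere_poly_def dist_norm norm_minus_commute)
        qed (use that in auto)
        moreover have "(norm (z - z0))\<^sup>2 < R\<^sup>2"
          using that by (intro power_strict_mono) (auto simp: dist_norm norm_minus_commute)
        ultimately show ?thesis
          by (simp add: sphere_poly_def)
      qed
      then show "v z = 0 z"
        using poly_zero_on_ball[OF polys_imp_poly[OF v] R, of z0 z] by simp
    qed
  qed
  then obtain q where q: "q \<in> polys k" "T q = laplacian p"
    by (auto simp: polys_def)
  show thesis
  proof (rule that[of "\<lambda>z. p z - ?w z * q z"])
    show "real_polynomial_function (\<lambda>z. p z - ?w z * q z)"
      by (intro poly_intros p mult q)
    show "laplacian (\<lambda>z. p z - ?w z * q z) = (\<lambda>z. 0)"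
      using q(2) laplacian_diff[OF p mult[OF q(1)]] by (simp add: T_def)
    show "p z - ?w z * q z = p z" if "z \<in> sphere z0 R" for z
      using that by (simp add: sphere_poly_def dist_norm norm_minus_commute)
  qed
qed

text \<open>Approximation by an arbitrary polynomial is needed on the sphere only. With that
  polynomial as boundary data, \<open>V + e - U\<close> and \<open>U - V + e\<close> are nonnegative
  on the sphere, and the maximum principle carries both inequalities inside.\<close>

lemma approx_by_harmonic_poly:
  fixes U :: "'a::euclidean_space \<times> real \<Rightarrow> real"
  assumes R: "R > 0" and U: "continuous_on (cball z0 R) U"
    and LU: "\<And>z. z \<in> ball z0 R \<Longrightarrow> (mean_laplacian U z \<longlongrightarrow> 0) (at_right 0)"
    and e: "e > 0"
  obtains V where "real_polynomial_function V" "laplacian V = (\<lambda>z. 0)"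
    "\<And>z. z \<in> cball z0 R \<Longrightarrow> \<bar>U z - V z\<bar> \<le> e"
proof -
  have "continuous_on (sphere z0 R) U"
    using U by (rule continuous_on_subset) auto
  then obtain p where p: "real_polynomial_function p" "\<And>z. z \<in> sphere z0 R \<Longrightarrow> \<bar>U z - p z\<bar> < e"
    using Stone_Weierstrass_real_polynomial_function[OF compact_sphere _ e] by blast
  obtain V where V: "real_polynomial_function V" "laplacian V = (\<lambda>z. 0)"
    "\<And>z. z \<in> sphere z0 R \<Longrightarrow> V z = p z"
    using dirichlet_poly[OF R p(1)] by blast
  show thesis
  proof (rule that[OF V(1,2)])
    fix z assume z: "z \<in> cball z0 R"
    have "U z \<le> V z + e"
    proof (rule maximum_principle_weak[OF R U LU _ _ _ z])
      show "real_polynomial_function (\<lambda>z. V z + e)"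
        by (intro poly_intros V)
      show "laplacian (\<lambda>z. V z + e) z \<le> 0" for z
        by (simp add: laplacian_add V poly_const)
      show "U z \<le> V z + e" if "z \<in> sphere z0 R" for z
        using p(2)[OF that] V(3)[OF that] by linarith
    qed
    moreover have "- U z \<le> e - V z"
    proof (rule maximum_principle_weak[OF R _ _ _ _ _ z])
      show "continuous_on (cball z0 R) (\<lambda>z. - U z)"
        by (intro continuous_intros U)
      show "(mean_laplacian (\<lambda>z. - U z) z \<longlongrightarrow> 0) (at_right 0)" if "z \<in> ball z0 R" for z
        using tendsto_minus[OF LU[OF that]] by (simp add: mean_laplacian_uminus[abs_def])
      show "real_polynomial_function (\<lambda>z. e - V z)"
        by (intro poly_intros V)
      show "laplacian (\<lambda>z. e - V z) z \<le> 0" for z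
        by (simp add: laplacian_diff V poly_const)
      show "- U z \<le> e - V z" if "z \<in> sphere z0 R" for z
        using p(2)[OF that] V(3)[OF that] by linarith
    qed
    ultimately show "\<bar>U z - V z\<bar> \<le> e" by linarith
  qed
qed

section \<open>Interior regularity\<close>

text \<open>Bernstein's method: with \<open>\<zeta> = sphere_poly z0 R\<close>, the constant is chosen such that
  \<open>\<zeta>\<^sup>2 * (partial_deriv b V)\<^sup>2 + constant * V\<^sup>2\<close> is subharmonic, so that it is
  bounded by its values on the sphere, where \<open>\<zeta>\<close> vanishes.\<close>

lemma bernstein_gradient_bound:
  fixes V :: "'a::euclidean_space \<times> real \<Rightarrow> real"
  assumes R: "R > 0" and V: "real_polynomial_function V" and harm: "laplacian V = (\<lambda>z. 0)"
    and b: "b \<in> Basis" and M: "\<And>z. z \<in> cball z0 R \<Longrightarrow> \<bar>V z\<bar> \<le> M"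
    and z: "z \<in> cball z0 R"
  shows "(sphere_poly z0 R z)\<^sup>2 * (partial_deriv b V z)\<^sup>2 \<le>
    (16 + 2 * real DIM('a \<times> real)) * R\<^sup>2 * M\<^sup>2"
proof -
  let ?N = "real DIM('a \<times> real)" and ?w = "sphere_poly z0 R" and ?v = "partial_deriv b V"
  \<comment> \<open>Chosen so that \<open>2 * \<alpha>\<close> exceeds (24 + 4 N) R^2, a bound for
    the coefficient of -w^2 that remains after the square is completed below.\<close>
  define \<alpha> where "\<alpha> = (16 + 2 * ?N) * R\<^sup>2"
  have \<alpha>: "\<alpha> \<ge> 0" by (simp add: \<alpha>_def)
  have v: "real_polynomial_function ?v"
    using V by auto
  have Lv: "laplacian ?v = (\<lambda>z. 0)"
    using laplacian_partial_deriv[OF V b] by (simp add: harm)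
  note pw = poly_sphere_poly[of z0 R]
  let ?W = "\<lambda>y. (?w y * ?w y) * (?v y * ?v y) + \<alpha> * (V y * V y)"
  have pW: "real_polynomial_function ?W"
    by (intro poly_intros pw v V)
  have "laplacian ?W y \<ge> 0" if y: "y \<in> ball z0 R" for y
  proof -
    define g where "g c = partial_deriv c ?v y" for c
    define h where "h c = partial_deriv c V y" for c
    define e where "e c = (y - z0) \<bullet> c" for c
    define \<zeta> where "\<zeta> = ?w y"
    define w where "w = ?v y"
    have \<rho>: "(\<Sum>c\<in>Basis. (e c)\<^sup>2) = (norm (y - z0))\<^sup>2"
      unfolding power2_norm_eq_inner euclidean_inner[of "y - z0" "y - z0"]
      by (simp add: e_def power2_eq_square)
    have "(norm (y - z0))\<^sup>2 \<le> R\<^sup>2"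
      using y by (intro power_mono) (auto simp: dist_norm norm_minus_commute)
    then have \<zeta>: "\<zeta> \<le> R\<^sup>2" and \<rho>R: "(\<Sum>c\<in>Basis. (e c)\<^sup>2) \<le> R\<^sup>2"
      by (simp_all add: \<zeta>_def sphere_poly_def \<rho>)
    \<comment> \<open>\<open>w\<close> is one component of the gradient of \<open>V\<close>, so the
      Laplacian of \<open>V^2\<close>, twice the squared gradient, can absorb multiples of
      w^2.\<close>
    have hb: "w\<^sup>2 \<le> (\<Sum>c\<in>Basis. (h c)\<^sup>2)"
      using member_le_sum[of b Basis "\<lambda>c. (h c)\<^sup>2"] b by (simp add: h_def w_def)
    have ww: "real_polynomial_function (\<lambda>y. ?w y * ?w y)"
      and vv: "real_polynomial_function (\<lambda>y. ?v y * ?v y)"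
      and VV: "real_polynomial_function (\<lambda>y. V y * V y)"
      by (intro poly_mult pw v V)+
    have Lww: "laplacian (\<lambda>y. ?w y * ?w y) y =
        2 * (\<zeta> * (- 2 * ?N)) + 2 * (\<Sum>c\<in>Basis. (- 2 * e c) * (- 2 * e c))"
      unfolding laplacian_mult[OF pw pw] laplacian_sphere_poly partial_deriv_sphere_poly \<zeta>_def e_def
      by (simp add: mult.commute del: DIM_prod)
    have Lvv: "laplacian (\<lambda>y. ?v y * ?v y) y = 2 * (\<Sum>c\<in>Basis. g c * g c)"
      by (simp add: laplacian_mult[OF v v] Lv g_def)
    have LVV: "laplacian (\<lambda>y. V y * V y) y = 2 * (\<Sum>c\<in>Basis. h c * h c)"
      by (simp add: laplacian_mult[OF V V] harm h_def)
    have Dww: "partial_deriv c (\<lambda>y. ?w y * ?w y) y = 2 * \<zeta> * (- 2 * e c)" for c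
      by (simp add: partial_deriv_mult[OF pw pw] partial_deriv_sphere_poly \<zeta>_def e_def)
    have Dvv: "partial_deriv c (\<lambda>y. ?v y * ?v y) y = 2 * w * g c" for c
      by (simp add: partial_deriv_mult[OF v v] w_def g_def)
    have "laplacian ?W y = (\<zeta> * \<zeta>) * (2 * (\<Sum>c\<in>Basis. g c * g c)) +
        (2 * (\<zeta> * (- 2 * ?N)) + 2 * (\<Sum>c\<in>Basis. (- 2 * e c) * (- 2 * e c))) * (w * w) +
        2 * (\<Sum>c\<in>Basis. (2 * \<zeta> * (- 2 * e c)) * (2 * w * g c)) +
        \<alpha> * (2 * (\<Sum>c\<in>Basis. h c * h c))"
      by (simp only: laplacian_add[OF poly_mult[OF ww vv] poly_mult[OF poly_const VV]]
          laplacian_cmult[OF VV] laplacian_mult[OF ww vv] Lww Lvv LVV Dww Dvv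
          flip: \<zeta>_def w_def)
    \<comment> \<open>The mixed term -16 \<zeta> w (e . g) has no sign. Completing the square with 2
      \<zeta>^2 |g|^2 costs 32 w^2 |e|^2; 8 w^2 |e|^2 is already present, which leaves the
      24.\<close>
    also have "\<dots> = 2 * (\<Sum>c\<in>Basis. (\<zeta> * g c - 4 * w * e c)\<^sup>2) +
        (2 * \<alpha> * (\<Sum>c\<in>Basis. (h c)\<^sup>2) - w\<^sup>2 * (24 * (\<Sum>c\<in>Basis. (e c)\<^sup>2) + 4 * ?N * \<zeta>))"
      by (simp add: power2_eq_square algebra_simps sum.distrib sum_subtractf sum_distrib_left
          sum_negf del: DIM_prod) (simp add: mult_ac flip: sum.distrib)
    also have "\<dots> \<ge> 0"
    proof -
      have "w\<^sup>2 * (24 * (\<Sum>c\<in>Basis. (e c)\<^sup>2) + 4 * ?N * \<zeta>) \<le> w\<^sup>2 * (24 * R\<^sup>2 + 4 * ?N * R\<^sup>2)"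
        using \<rho>R \<zeta> by (intro mult_left_mono add_mono) auto
      also have "\<dots> \<le> w\<^sup>2 * (2 * \<alpha>)"
        by (intro mult_left_mono) (auto simp: \<alpha>_def algebra_simps)
      also have "\<dots> \<le> 2 * \<alpha> * (\<Sum>c\<in>Basis. (h c)\<^sup>2)"
        using mult_left_mono[OF hb, of "2 * \<alpha>"] \<alpha> by (simp add: mult.commute)
      finally show ?thesis
        by (simp add: sum_nonneg del: DIM_prod)
    qed
    finally show ?thesis .
  qed
  note LW = this
  have "0 \<le> \<alpha> * M\<^sup>2 - ?W z"
  proof (rule maximum_principle_weak[OF R continuous_on_const mean_laplacian_zero])
    show "real_polynomial_function (\<lambda>y. \<alpha> * M\<^sup>2 - ?W y)"
      by (intro real_polynomial_function_diff poly_const pW)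
    show "laplacian (\<lambda>y. \<alpha> * M\<^sup>2 - ?W y) y \<le> 0" if "y \<in> ball z0 R" for y
      using LW[OF that] laplacian_diff[OF poly_const pW, of "\<alpha> * M\<^sup>2"] by simp
    show "0 \<le> \<alpha> * M\<^sup>2 - ?W y" if "y \<in> sphere z0 R" for y
    proof -
      have "\<bar>V y\<bar>\<^sup>2 \<le> M\<^sup>2"
        using that by (intro power_mono M) auto
      then have "\<alpha> * (V y * V y) \<le> \<alpha> * M\<^sup>2"
        using \<alpha> by (intro mult_left_mono) (auto simp: power2_eq_square)
      moreover have "?w y = 0"
        using that by (simp add: sphere_poly_def dist_norm norm_minus_commute)
      ultimately show ?thesis by simp
    qed
  qed (use z in auto)
  moreover have "0 \<le> \<alpha> * (V z * V z)"
    using \<alpha> by simp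
  ultimately show ?thesis
    by (simp add: \<alpha>_def power2_eq_square algebra_simps del: DIM_prod)
qed

text \<open>The order of quantifiers is the point: \<open>K\<close> is fixed before
  \<open>V\<close>, so one constant serves all differences of members of a sequence.\<close>

lemma interior_derivative_bound:
  fixes z0 :: "'a::euclidean_space \<times> real"
  assumes R: "R > 0"
  obtains K where "K > 0" "\<And>V M b z. real_polynomial_function V \<Longrightarrow>
    laplacian V = (\<lambda>z::'a \<times> real. 0) \<Longrightarrow> b \<in> Basis \<Longrightarrow> (\<And>z. z \<in> cball z0 R \<Longrightarrow> \<bar>V z\<bar> \<le> M) \<Longrightarrow> z \<in> cball z0 (R/2) \<Longrightarrow>
    \<bar>partial_deriv b V z\<bar> \<le> K * M"
proof -
  define A where "A = (16 + 2 * real DIM('a \<times> real)) * R\<^sup>2"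
  \<comment> \<open>On the half ball, \<open>sphere_poly z0 R\<close> is at least R^2 - R^2 /
    4.\<close>
  define c where "c = 3 / 4 * R\<^sup>2"
  define K where "K = sqrt A / c"
  have A: "A > 0"
    using R unfolding A_def by (intro mult_pos_pos add_pos_nonneg) auto
  have c: "c > 0" using R by (simp add: c_def)
  show thesis
  proof (rule that)
    show "K > 0" using A c by (simp add: K_def)
    fix V :: "'a \<times> real \<Rightarrow> real" and M :: real and b z :: "'a \<times> real"
    assume V: "real_polynomial_function V" "laplacian V = (\<lambda>z. 0)" "b \<in> Basis"
      and M: "\<And>z. z \<in> cball z0 R \<Longrightarrow> \<bar>V z\<bar> \<le> M" and z: "z \<in> cball z0 (R/2)"
    have "\<bar>V z0\<bar> \<le> M" using M[of z0] R by simp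
    then have M0: "M \<ge> 0" by linarith
    have "(norm (z - z0))\<^sup>2 \<le> (R / 2)\<^sup>2"
      using z by (intro power_mono) (auto simp: dist_norm norm_minus_commute)
    then have cw: "c \<le> sphere_poly z0 R z"
      by (simp add: c_def sphere_poly_def power_divide)
    have zR: "z \<in> cball z0 R" using z R by auto
    have "(c * \<bar>partial_deriv b V z\<bar>)\<^sup>2 \<le> (sphere_poly z0 R z)\<^sup>2 * (partial_deriv b V z)\<^sup>2"
      using cw c by (simp add: power_mult_distrib mult_right_mono power_mono)
    also have "\<dots> \<le> A * M\<^sup>2"
      unfolding A_def by (rule bernstein_gradient_bound[OF R V M zR])
    also have "\<dots> = (sqrt A * M)\<^sup>2"
      using A by (simp add: power_mult_distrib)
    finally have "c * \<bar>partial_deriv b V z\<bar> \<le> sqrt A * M"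
      using A M0 by (rule_tac power2_le_imp_le) auto
    then show "\<bar>partial_deriv b V z\<bar> \<le> K * M"
      using c by (simp add: K_def field_simps)
  qed
qed

text \<open>Differences of the \<open>V n\<close> are again harmonic, so the interior bound makes
  their partial derivatives uniformly Cauchy on the half ball. Differentiating the sequence along
  lines identifies the limit as the partial derivative of \<open>U\<close>.\<close>

lemma partial_deriv_uniform_limit:
  fixes U :: "'a::euclidean_space \<times> real \<Rightarrow> real"
  assumes R: "R > 0" and V: "\<And>n. real_polynomial_function (V n)"
    and harm: "\<And>n. laplacian (V n) = (\<lambda>z. 0)"
    and lim: "uniform_limit (cball z0 R) V U sequentially" and b: "b \<in> Basis"
  shows "uniform_limit (ball z0 (R/2)) (\<lambda>n. partial_deriv b (V n)) (partial_deriv b U) sequentially"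
    and "\<And>z. z \<in> ball z0 (R/2) \<Longrightarrow> (\<lambda>t. U (z + t *\<^sub>R b)) field_differentiable at 0"
proof -
  obtain K where K: "K > 0" and bound: "\<And>V M b z. real_polynomial_function V \<Longrightarrow>
    laplacian V = (\<lambda>z. 0) \<Longrightarrow> b \<in> Basis \<Longrightarrow> (\<And>z. z \<in> cball z0 R \<Longrightarrow> \<bar>V z\<bar> \<le> M) \<Longrightarrow>
    z \<in> cball z0 (R/2) \<Longrightarrow> \<bar>partial_deriv b V z\<bar> \<le> K * M"
    using interior_derivative_bound[OF R] by metis
  have "uniformly_Cauchy_on (ball z0 (R/2)) (\<lambda>n. partial_deriv b (V n))"
  proof (rule uniformly_Cauchy_onI)
    fix e :: real assume e: "e > 0"
    have "uniformly_Cauchy_on (cball z0 R) V"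
      using lim by (intro uniformly_convergent_Cauchy) (auto simp: uniformly_convergent_on_def)
    moreover have "e / (2 * K) > 0" using e K by simp
    ultimately obtain N where N: "\<And>z m n. z \<in> cball z0 R \<Longrightarrow> m \<ge> N \<Longrightarrow> n \<ge> N \<Longrightarrow>
      dist (V m z) (V n z) < e / (2 * K)"
      unfolding uniformly_Cauchy_on_def by blast
    have "dist (partial_deriv b (V m) z) (partial_deriv b (V n) z) < e"
      if z: "z \<in> ball z0 (R/2)" and mn: "m \<ge> N" "n \<ge> N" for z m n
    proof -
      have "\<bar>partial_deriv b (\<lambda>z. V m z - V n z) z\<bar> \<le> K * (e / (2 * K))"
      proof (rule bound)
        show "laplacian (\<lambda>z. V m z - V n z) = (\<lambda>z. 0)"
          using harm V by (simp add: laplacian_diff)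
        show "\<bar>V m y - V n y\<bar> \<le> e / (2 * K)" if "y \<in> cball z0 R" for y
          using N[OF that mn] by (simp add: dist_real_def)
      qed (use V b z in \<open>auto intro: poly_intros\<close>)
      then show ?thesis
        using V K e by (simp add: partial_deriv_diff dist_real_def)
    qed
    then show "\<exists>N. \<forall>z\<in>ball z0 (R/2). \<forall>m\<ge>N. \<forall>n\<ge>N.
        dist (partial_deriv b (V m) z) (partial_deriv b (V n) z) < e"
      by blast
  qed
  then obtain G where G: "uniform_limit (ball z0 (R/2)) (\<lambda>n. partial_deriv b (V n)) G sequentially"
    using Cauchy_uniformly_convergent unfolding uniformly_convergent_on_def by blast
  have deriv: "((\<lambda>t. U (z + t *\<^sub>R b)) has_field_derivative G z) (at 0)" if z: "z \<in> ball z0 (R/2)" for z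
  proof -
    obtain d where d: "d > 0" "ball z d \<subseteq> ball z0 (R/2)"
      using z open_ball by (metis open_contains_ball)
    define S where "S = ball (0::real) d"
    have zS: "z + t *\<^sub>R b \<in> ball z0 (R/2)" if "t \<in> S" for t
      using that b by (intro subsetD[OF d(2)]) (simp add: S_def dist_norm)
    \<comment> \<open>Convergence at parameter 0 and uniform convergence of the derivatives yield a
      differentiable limit \<open>g\<close> on the segment; uniqueness of limits then identifies it
      with \<open>U\<close>.\<close>
    have "\<exists>g. \<forall>t\<in>S. (\<lambda>n. V n (z + t *\<^sub>R b)) \<longlonglongrightarrow> g t \<and>
        (g has_derivative (\<lambda>h. G (z + t *\<^sub>R b) * h)) (at t within S)"
    proof (rule has_derivative_sequence)
      show "convex S" by (simp add: S_def)
      show "((\<lambda>t. V n (z + t *\<^sub>R b)) has_derivative (\<lambda>h. partial_deriv b (V n) (z + t *\<^sub>R b) * h))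
          (at t within S)" for n t
        using poly_has_partial_deriv[OF V b]
        unfolding has_field_derivative_def by (rule has_derivative_at_withinI)
      show "0 \<in> S" using d by (simp add: S_def)
      show "(\<lambda>n. V n (z + 0 *\<^sub>R b)) \<longlonglongrightarrow> U z"
        using tendsto_uniform_limitI[OF lim, of z] z R by auto
      fix e :: real assume "e > 0"
      with G have "\<forall>\<^sub>F n in sequentially. \<forall>y\<in>ball z0 (R/2). dist (partial_deriv b (V n) y) (G y) < e"
        by (rule uniform_limitD)
      then show "\<forall>\<^sub>F n in sequentially. \<forall>t\<in>S. \<forall>h.
          norm (partial_deriv b (V n) (z + t *\<^sub>R b) * h - G (z + t *\<^sub>R b) * h) \<le> e * norm h"
      proof (rule eventually_mono, intro ballI allI)
        fix n t h
        assume *: "\<forall>y\<in>ball z0 (R/2). dist (partial_deriv b (V n) y) (G y) < e" and "t \<in> S"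
        then have "\<bar>partial_deriv b (V n) (z + t *\<^sub>R b) - G (z + t *\<^sub>R b)\<bar> \<le> e"
          using zS by (simp add: dist_real_def less_imp_le)
        then show "norm (partial_deriv b (V n) (z + t *\<^sub>R b) * h - G (z + t *\<^sub>R b) * h) \<le> e * norm h"
          by (simp add: abs_mult mult_right_mono flip: left_diff_distrib)
      qed
    qed
    then obtain g where g: "\<And>t. t \<in> S \<Longrightarrow> (\<lambda>n. V n (z + t *\<^sub>R b)) \<longlonglongrightarrow> g t"
      "\<And>t. t \<in> S \<Longrightarrow> (g has_derivative (\<lambda>h. G (z + t *\<^sub>R b) * h)) (at t within S)"
      by blast
    have gU: "g t = U (z + t *\<^sub>R b)" if "t \<in> S" for t
    proof -
      have "z + t *\<^sub>R b \<in> cball z0 R"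
        using zS[OF that] R by auto
      then have "(\<lambda>n. V n (z + t *\<^sub>R b)) \<longlonglongrightarrow> U (z + t *\<^sub>R b)"
        by (rule tendsto_uniform_limitI[OF lim])
      with g(1)[OF that] show ?thesis
        using LIMSEQ_unique by blast
    qed
    have S: "open S" "0 \<in> S" using d by (simp_all add: S_def)
    have "(g has_field_derivative G z) (at 0)"
      using g(2)[OF S(2)] by (simp add: has_field_derivative_def at_within_open[OF S(2,1)])
    then show ?thesis
      using S gU by (rule has_field_derivative_transform_within_open)
  qed
  then show "(\<lambda>t. U (z + t *\<^sub>R b)) field_differentiable at 0" if "z \<in> ball z0 (R/2)" for z
    using that field_differentiable_def by blast
  have "partial_deriv b U z = G z" if "z \<in> ball z0 (R/2)" for z
    unfolding partial_deriv_def using deriv[OF that] by (rule DERIV_imp_deriv)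
  with G show "uniform_limit (ball z0 (R/2)) (\<lambda>n. partial_deriv b (V n)) (partial_deriv b U) sequentially"
    by (subst uniform_limit_cong'[OF refl]) auto
qed

lemma uniform_limit_harmonic_C1:
  fixes U :: "'a::euclidean_space \<times> real \<Rightarrow> real"
  assumes R: "R > 0" and V: "\<And>n. real_polynomial_function (V n)"
    and harm: "\<And>n. laplacian (V n) = (\<lambda>z. 0)"
    and lim: "uniform_limit (cball z0 R) V U sequentially"
  shows "C1_on (ball z0 (R/2)) U"
  unfolding C1_on_def
proof (intro ballI conjI)
  fix b :: "'a \<times> real" assume b: "b \<in> Basis"
  note * = partial_deriv_uniform_limit[OF assms b]
  show "(\<lambda>t. U (z + t *\<^sub>R b)) field_differentiable at 0" if "z \<in> ball z0 (R/2)" for z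
    using * that by blast
  show "continuous_on (ball z0 (R/2)) (partial_deriv b U)"
    by (rule uniform_limit_theorem[OF _ *(1)])
      (auto intro!: always_eventually poly_continuous_on V)
qed

text \<open>Each derivative halves the radius, and the next application needs uniform convergence on
  a closed ball: from the open ball of radius R/2 to the closed one of radius R/3, and from there to
  R/6.\<close>

lemma uniform_limit_harmonic:
  fixes U :: "'a::euclidean_space \<times> real \<Rightarrow> real"
  assumes R: "R > 0" and V: "\<And>n. real_polynomial_function (V n)"
    and harm: "\<And>n. laplacian (V n) = (\<lambda>z. 0)"
    and lim: "uniform_limit (cball z0 R) V U sequentially"
  shows "C2_on (ball z0 (R/6)) U" and "\<And>z. z \<in> ball z0 (R/6) \<Longrightarrow> laplacian U z = 0"
proof -
  have R3: "R / 3 > 0" using R by simp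
  let ?V = "\<lambda>b n. partial_deriv b (V n)"
  have pV: "real_polynomial_function (?V b n)" for b n
    using V by auto
  have hV: "laplacian (?V b n) = (\<lambda>z. 0)" if "b \<in> Basis" for b n
    using laplacian_partial_deriv[OF V that] by (simp add: harm)
  have lim': "uniform_limit (cball z0 (R/3)) (?V b) (partial_deriv b U) sequentially"
    if "b \<in> Basis" for b
    using partial_deriv_uniform_limit(1)[OF assms that]
    by (rule uniform_limit_on_subset) (use R in auto)
  have "C1_on (ball z0 (R/6)) (partial_deriv b U)" if "b \<in> Basis" for b
    using uniform_limit_harmonic_C1[OF R3 pV hV[OF that] lim'[OF that]] by simp
  moreover have "C1_on (ball z0 (R/6)) U"
  proof -
    have "ball z0 (R/6) \<subseteq> ball z0 (R/2)"
      using R by (intro subset_ball) simp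
    then show ?thesis
      using uniform_limit_harmonic_C1[OF assms] unfolding C1_on_def
      by (meson continuous_on_subset subsetD)
  qed
  ultimately show "C2_on (ball z0 (R/6)) U"
    by (simp add: C2_on_def)
  show "laplacian U z = 0" if z: "z \<in> ball z0 (R/6)" for z
  proof -
    have "(\<lambda>n. laplacian (V n) z) \<longlonglongrightarrow> laplacian U z"
      unfolding laplacian_def
    proof (intro tendsto_sum)
      fix b :: "'a \<times> real" assume b: "b \<in> Basis"
      show "(\<lambda>n. partial_deriv b (?V b n) z) \<longlonglongrightarrow> partial_deriv b (partial_deriv b U) z"
        using partial_deriv_uniform_limit(1)[OF R3 pV hV[OF b] lim'[OF b] b] z
        by (intro tendsto_uniform_limitI) auto
    qed
    then show ?thesis
      by (simp add: harm LIMSEQ_const_iff)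
  qed
qed

text \<open>A counterpart of Weyl's lemma for the mean Laplacian: approximation to within 1 / (n +
  1) by harmonic polynomials gives the sequence to which the limit theorem applies.\<close>

lemma mean_laplacian_zero_imp_harmonic:
  fixes U :: "'a::euclidean_space \<times> real \<Rightarrow> real"
  assumes R: "R > 0" and U: "continuous_on (cball z0 R) U"
    and LU: "\<And>z. z \<in> ball z0 R \<Longrightarrow> (mean_laplacian U z \<longlongrightarrow> 0) (at_right 0)"
  shows "C2_on (ball z0 (R/6)) U" and "\<And>z. z \<in> ball z0 (R/6) \<Longrightarrow> laplacian U z = 0"
proof -
  have "\<exists>V. real_polynomial_function V \<and> laplacian V = (\<lambda>z. 0) \<and>
      (\<forall>z\<in>cball z0 R. \<bar>U z - V z\<bar> \<le> inverse (real (Suc n)))" for n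
  proof -
    have "inverse (real (Suc n)) > 0" by simp
    from approx_by_harmonic_poly[OF R U LU this] show ?thesis by metis
  qed
  then obtain V where V: "\<And>n. real_polynomial_function (V n)" "\<And>n. laplacian (V n) = (\<lambda>z. 0)"
    "\<And>n z. z \<in> cball z0 R \<Longrightarrow> \<bar>U z - V n z\<bar> \<le> inverse (real (Suc n))"
    by metis
  have "uniform_limit (cball z0 R) V U sequentially"
  proof (rule uniform_limitI)
    fix e :: real assume "e > 0"
    with LIMSEQ_inverse_real_of_nat have "\<forall>\<^sub>F n in sequentially. inverse (real (Suc n)) < e"
      by (rule order_tendstoD)
    then show "\<forall>\<^sub>F n in sequentially. \<forall>z\<in>cball z0 R. dist (V n z) (U z) < e"
    proof eventually_elim
      case (elim n)
      show ?case
      proof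
        fix z assume "z \<in> cball z0 R"
        from V(3)[OF this, of n] elim show "dist (V n z) (U z) < e"
          by (simp add: dist_real_def abs_minus_commute)
      qed
    qed
  qed
  from uniform_limit_harmonic[OF R V(1,2) this]
  show "C2_on (ball z0 (R/6)) U" "\<And>z. z \<in> ball z0 (R/6) \<Longrightarrow> laplacian U z = 0"
    by blast+
qed

section \<open>The mean value property of metaharmonic functions\<close>

text \<open>After division by (z/2)^\<nu>, the Bessel series is a power series \<open>g\<close> in w
  = (z/2)^2, and \<open>Gamma (\<nu> + 1) * g 0 = 1\<close>. The expression is thus a difference
  quotient of \<open>g\<close> at 0 up to a constant factor, and the limit comes from its second
  coefficient.\<close>

lemma Bessel_J_asymptotics:
  fixes \<nu> lam :: real
  assumes \<nu>: "\<nu> \<ge> 0" and lam: "lam > 0"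
  shows "((\<lambda>r. (Gamma (\<nu> + 1) * (Bessel_J \<nu> (lam * r) / (lam * r / 2) powr \<nu>) - 1) / r\<^sup>2) \<longlongrightarrow>
    - lam\<^sup>2 / (4 * (\<nu> + 1))) (at_right 0)"
proof -
  define c where "c k = (-1) ^ k / (fact k * Gamma (real k + \<nu> + 1))" for k
  have G: "Gamma (real k + \<nu> + 1) > 0" for k
    using \<nu> by (intro Gamma_real_pos) linarith
  have G1: "Gamma (real (Suc k) + \<nu> + 1) = (real k + \<nu> + 1) * Gamma (real k + \<nu> + 1)" for k
  proof -
    have "real k + \<nu> + 1 \<notin> \<int>\<^sub>\<le>\<^sub>0"
      using \<nu> by (auto elim!: nonpos_Ints_cases)
    from Gamma_plus1[OF this] show ?thesis
      by (simp add: algebra_simps)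
  qed
  have c_Suc: "c (Suc k) = - c k / (real (Suc k) * (real k + \<nu> + 1))" for k
    unfolding c_def G1 using G[of k] by (simp add: field_simps)
  \<comment> \<open>Convergence at 1 gives radius of convergence at least 1, which is enough near 0;
    this is the origin of the restriction z < 2 below.\<close>
  have summ: "summable c"
  proof (rule summable_ratio_test)
    fix k :: nat assume k: "k \<ge> 1"
    have "2 * 1 \<le> real (Suc k) * (real k + \<nu> + 1)"
      using k \<nu> by (intro mult_mono) auto
    then have "\<bar>c k\<bar> / (real (Suc k) * (real k + \<nu> + 1)) \<le> \<bar>c k\<bar> / 2"
      by (intro divide_left_mono) auto
    then show "norm (c (Suc k)) \<le> 1 / 2 * norm (c k)"
      using \<nu> unfolding c_Suc by (simp add: abs_mult)
  qed simp
  define g where "g w = (\<Sum>k. c k * w ^ k)" for w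
  have deriv: "(g has_field_derivative c 1) (at 0)"
  proof -
    have "DERIV (\<lambda>w. \<Sum>k. c k * w ^ k) 0 :> (\<Sum>k. diffs c k * 0 ^ k)"
      by (rule termdiffs_strong[of c 1]) (use summ in auto)
    \<comment> \<open>At 0 only the constant term \<open>diffs c 0 = c 1\<close> of the
      differentiated series remains.\<close>
    then show ?thesis
      unfolding powser_zero by (simp add: g_def[abs_def] diffs_def)
  qed
  have g0: "g 0 = c 0"
    by (simp add: g_def)
  have Bessel: "Bessel_J \<nu> z / (z / 2) powr \<nu> = g ((z / 2)\<^sup>2)" if z: "0 < z" "z < 2" for z
  proof -
    have "(z / 2)\<^sup>2 < 1"
      using z abs_square_less_1[of "z / 2"] by simp
    then have "summable (\<lambda>k. c k * ((z / 2)\<^sup>2) ^ k)"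
      using powser_inside[of c 1] summ by simp
    then have "(z / 2) powr \<nu> * g ((z / 2)\<^sup>2) = (\<Sum>k. (z / 2) powr \<nu> * (c k * ((z / 2)\<^sup>2) ^ k))"
      unfolding g_def by (rule suminf_mult[symmetric])
    also have "\<dots> = Bessel_J \<nu> z"
      unfolding Bessel_J_def
    proof (intro suminf_cong)
      fix k
      have "(z / 2) powr (2 * real k + \<nu>) = (z / 2) powr real (2 * k) * (z / 2) powr \<nu>"
        by (simp add: powr_add)
      also have "(z / 2) powr real (2 * k) = ((z / 2)\<^sup>2) ^ k"
        using z by (simp add: powr_realpow power_mult del: of_nat_mult)
      finally show "(z / 2) powr \<nu> * (c k * ((z / 2)\<^sup>2) ^ k) =
          (- 1) ^ k / (fact k * Gamma (real k + \<nu> + 1)) * (z / 2) powr (2 * real k + \<nu>)"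
        by (simp add: c_def)
    qed
    finally show ?thesis
      using z by (simp add: field_simps)
  qed
  let ?\<Gamma> = "Gamma (\<nu> + 1)"
  have \<Gamma>0: "?\<Gamma> * c 0 = 1"
    using G[of 0] by (simp add: c_def)
  then have \<Gamma>1: "?\<Gamma> * c 1 = - 1 / (\<nu> + 1)"
    using c_Suc[of 0] by simp
  have "((\<lambda>w. (g w - g 0) / w) \<longlongrightarrow> c 1) (at 0)"
    using deriv by (simp add: has_field_derivative_iff)
  \<comment> \<open>The target filter \<open>at 0\<close> also records that the argument avoids 0,
    as the difference quotient requires.\<close>
  moreover have "filterlim (\<lambda>r. (lam * r / 2)\<^sup>2) (at 0) (at_right 0)"
    using lam by real_asymp
  ultimately have "((\<lambda>r. (g ((lam * r / 2)\<^sup>2) - g 0) / (lam * r / 2)\<^sup>2) \<longlongrightarrow> c 1) (at_right 0)"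
    by (rule filterlim_compose)
  \<comment> \<open>As w = lam^2 r^2 / 4 and \<open>?\<Gamma> * c 0 = 1\<close>, this factor
    converts the quotient in w into the quotient by r^2 of the claim.\<close>
  then have "((\<lambda>r. ?\<Gamma> * lam\<^sup>2 / 4 * ((g ((lam * r / 2)\<^sup>2) - g 0) / (lam * r / 2)\<^sup>2)) \<longlongrightarrow>
      ?\<Gamma> * lam\<^sup>2 / 4 * c 1) (at_right 0)"
    by (rule tendsto_mult_left)
  moreover have "?\<Gamma> * lam\<^sup>2 / 4 * c 1 = - lam\<^sup>2 / (4 * (\<nu> + 1))"
  proof -
    have "?\<Gamma> * lam\<^sup>2 / 4 * c 1 = lam\<^sup>2 / 4 * (?\<Gamma> * c 1)"
      by simp
    also have "\<dots> = - lam\<^sup>2 / (4 * (\<nu> + 1))"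
      unfolding \<Gamma>1 by simp
    finally show ?thesis .
  qed
  ultimately have lim: "((\<lambda>r. ?\<Gamma> * lam\<^sup>2 / 4 * ((g ((lam * r / 2)\<^sup>2) - g 0) / (lam * r / 2)\<^sup>2)) \<longlongrightarrow>
      - lam\<^sup>2 / (4 * (\<nu> + 1))) (at_right 0)"
    by (simp only:)
  have "\<forall>\<^sub>F r in at_right 0. ?\<Gamma> * lam\<^sup>2 / 4 * ((g ((lam * r / 2)\<^sup>2) - g 0) / (lam * r / 2)\<^sup>2) =
      (?\<Gamma> * (Bessel_J \<nu> (lam * r) / (lam * r / 2) powr \<nu>) - 1) / r\<^sup>2"
    unfolding eventually_at_right_field
  proof (intro exI conjI allI impI)
    show "0 < 2 / lam" using lam by simp
    fix r :: real assume r: "0 < r" "r < 2 / lam"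
    then have B: "Bessel_J \<nu> (lam * r) / (lam * r / 2) powr \<nu> = g ((lam * r / 2)\<^sup>2)"
      using lam by (intro Bessel) (auto simp: field_simps)
    have "?\<Gamma> * lam\<^sup>2 / 4 * (x / (lam * r / 2)\<^sup>2) = ?\<Gamma> * x / r\<^sup>2" for x
      using lam r by (simp add: power_mult_distrib power_divide)
    then show "?\<Gamma> * lam\<^sup>2 / 4 * ((g ((lam * r / 2)\<^sup>2) - g 0) / (lam * r / 2)\<^sup>2) =
      (?\<Gamma> * (Bessel_J \<nu> (lam * r) / (lam * r / 2) powr \<nu>) - 1) / r\<^sup>2"
      unfolding B g0 by (simp only: right_diff_distrib \<Gamma>0)
  qed
  with lim show ?thesis
    by (rule Lim_transform_eventually)
qed

text \<open>With \<nu> + 1 = m / 2 the Bessel limit is -lam^2 / (2m); the factor 2m in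
  \<open>mean_laplacian\<close> turns it into -lam^2, which the second difference of the exponential
  cancels.\<close>

lemma mean_laplacian_times_exp:
  fixes u :: "'a::euclidean_space \<Rightarrow> real"
  assumes dim: "DIM('a) \<ge> 2" and lam: "lam > 0" and \<rho>: "\<rho> > 0"
    and mean: "\<And>r. 0 < r \<Longrightarrow> r < \<rho> \<Longrightarrow>
      Gamma (real DIM('a) / 2) * (Bessel_J ((real DIM('a) - 2) / 2) (lam * r)
        / (lam * r / 2) powr ((real DIM('a) - 2) / 2)) * u x = sphere_mean u x r"
  shows "(mean_laplacian (\<lambda>z. u (fst z) * exp (lam * snd z)) (x, t) \<longlongrightarrow> 0) (at_right 0)"
proof -
  let ?m = "real DIM('a)"
  define \<nu> where "\<nu> = (?m - 2) / 2"
  have \<nu>: "\<nu> \<ge> 0" "\<nu> + 1 = ?m / 2"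
    using dim by (simp_all add: \<nu>_def field_simps)
  define j where "j r = Gamma (\<nu> + 1) * (Bessel_J \<nu> (lam * r) / (lam * r / 2) powr \<nu>)" for r
  have "((\<lambda>r. (j r - 1) / r\<^sup>2) \<longlongrightarrow> - lam\<^sup>2 / (2 * ?m)) (at_right 0)"
    using Bessel_J_asymptotics[OF \<nu>(1) lam] unfolding j_def \<nu>(2) by (simp add: mult.commute)
  moreover have "((\<lambda>r. (exp (lam * r) + exp (- lam * r) - 2) / r\<^sup>2) \<longlongrightarrow> lam\<^sup>2) (at_right 0)"
    using lam by (real_asymp simp: power2_eq_square)
  ultimately have "((\<lambda>r. u x * exp (lam * t) * (2 * ?m * ((j r - 1) / r\<^sup>2) +
      (exp (lam * r) + exp (- lam * r) - 2) / r\<^sup>2)) \<longlongrightarrow>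
      u x * exp (lam * t) * (2 * ?m * (- lam\<^sup>2 / (2 * ?m)) + lam\<^sup>2)) (at_right 0)"
    by (intro tendsto_add tendsto_mult tendsto_const)
  moreover have "2 * ?m * (- lam\<^sup>2 / (2 * ?m)) + lam\<^sup>2 = 0"
    by (simp add: field_simps)
  moreover have "\<forall>\<^sub>F r in at_right 0. u x * exp (lam * t) * (2 * ?m * ((j r - 1) / r\<^sup>2) +
      (exp (lam * r) + exp (- lam * r) - 2) / r\<^sup>2) =
      mean_laplacian (\<lambda>z. u (fst z) * exp (lam * snd z)) (x, t) r"
    unfolding eventually_at_right_field
  proof (intro exI conjI allI impI)
    fix r :: real assume r: "0 < r" "r < \<rho>"
    have "sphere_mean (\<lambda>y. u y * exp (lam * t)) x r = sphere_mean u x r * exp (lam * t)"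
      by (simp add: sphere_mean_def)
    also have "sphere_mean u x r = j r * u x"
      using mean[OF r] by (simp add: j_def \<nu>(2)) (simp add: \<nu>_def)
    finally show "u x * exp (lam * t) * (2 * ?m * ((j r - 1) / r\<^sup>2) +
      (exp (lam * r) + exp (- lam * r) - 2) / r\<^sup>2) =
      mean_laplacian (\<lambda>z. u (fst z) * exp (lam * snd z)) (x, t) r"
      using r by (simp add: mean_laplacian_def distrib_left right_diff_distrib exp_add exp_diff
          exp_minus field_simps)
  qed (rule \<rho>)
  ultimately show ?thesis
    by (simp add: tendsto_cong)
qed

section \<open>From harmonicity in the product space back to \<open>u\<close>\<close>

lemma C1_on_locally:
  assumes "\<And>x. x \<in> S \<Longrightarrow> \<exists>e>0. C1_on (ball x e) f"
  shows "C1_on S f"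
  unfolding C1_on_def
proof (intro ballI conjI)
  fix b :: 'a assume b: "b \<in> Basis"
  show "(\<lambda>t. f (x + t *\<^sub>R b)) field_differentiable at 0" if "x \<in> S" for x
    using assms[OF that] b by (auto simp: C1_on_def)
  show "continuous_on S (partial_deriv b f)"
  proof (rule continuous_at_imp_continuous_on, rule ballI)
    fix x assume x: "x \<in> S"
    obtain e where "e > 0" "continuous_on (ball x e) (partial_deriv b f)"
      using assms[OF x] b by (auto simp: C1_on_def)
    then show "isCont (partial_deriv b f) x"
      by (simp add: continuous_on_eq_continuous_at)
  qed
qed

lemma C2_on_locally:
  assumes "\<And>x. x \<in> S \<Longrightarrow> \<exists>e>0. C2_on (ball x e) f"
  shows "C2_on S f"
  unfolding C2_on_def using assms
  by (auto intro!: C1_on_locally simp: C2_on_def) blast+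

text \<open>Stated for an arbitrary pair \<open>U\<close>, \<open>u\<close> because it is applied
  both to the lifted function and to its partial derivatives in the directions
  \<open>(b, 0)\<close>.\<close>

lemma C1_on_slice:
  assumes "C1_on (ball (x, 0::real) e) U" and "\<And>y. U (y, 0) = u y"
  shows "C1_on (ball x e) u"
  unfolding C1_on_def
proof (intro ballI conjI)
  fix b :: 'a assume b: "b \<in> Basis"
  then have b': "(b, 0::real) \<in> Basis"
    by (simp add: Basis_prod_def)
  have in_ball: "(y, 0::real) \<in> ball (x, 0) e" if "y \<in> ball x e" for y
    using that by (simp add: dist_Pair_Pair)
  show "(\<lambda>t. u (y + t *\<^sub>R b)) field_differentiable at 0" if "y \<in> ball x e" for y
  proof -
    have "(\<lambda>t. U ((y, 0) + t *\<^sub>R (b, 0))) field_differentiable at 0"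
      using assms(1) b' in_ball[OF that] unfolding C1_on_def by blast
    then show ?thesis by (simp add: assms(2))
  qed
  have "continuous_on (ball (x, 0) e) (partial_deriv (b, 0) U)"
    using assms(1) b' by (auto simp: C1_on_def)
  then have "continuous_on (ball x e) (\<lambda>y. partial_deriv (b, 0) U (y, 0))"
    by (rule continuous_on_compose2) (use in_ball in \<open>auto intro!: continuous_intros\<close>)
  then show "continuous_on (ball x e) (partial_deriv b u)"
    by (simp add: partial_deriv_fst assms(2))
qed

theorem theorem4:
  fixes D :: "(real ^ 'm) set" and u :: "real ^ 'm \<Rightarrow> real"
    and lam :: real and \<rho> :: "real ^ 'm \<Rightarrow> real"
  assumes dim: "CARD('m) \<ge> 2"
    and domain: "open D" "connected D" "bounded D"
    and cont: "continuous_on D u"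
    and lam: "lam > 0"
    and admissible: "\<And>x. x \<in> D \<Longrightarrow> \<rho> x > 0 \<and> closure (ball x (\<rho> x)) \<subseteq> D"
    and mean_value: "\<And>x r. x \<in> D \<Longrightarrow> r \<in> {0<..<\<rho> x} \<Longrightarrow>
      Gamma (real CARD('m) / 2)
        * (Bessel_J ((real CARD('m) - 2) / 2) (lam * r)
            / (lam * r / 2) powr ((real CARD('m) - 2) / 2)) * u x
      = 1 / sphere_area CARD('m) r * (\<integral>y. u y \<partial>sphere_measure x r)"
  shows "metaharmonic_on lam D u"
proof -
  define U where "U z = u (fst z) * exp (lam * snd z)" for z :: "(real ^ 'm) \<times> real"
  have U0: "U (y, 0) = u y" for y
    by (simp add: U_def)
  have slice: "partial_deriv (b, 0) U (y, 0) = partial_deriv b u y" for b y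
    by (simp add: partial_deriv_fst U0)
  \<comment> \<open>The only place where \<open>\<rho>\<close> enters: each point uses its own
    radius, and the limit statement no longer mentions it.\<close>
  have LU: "(mean_laplacian U z \<longlongrightarrow> 0) (at_right 0)" if "fst z \<in> D" for z
    unfolding U_def[abs_def]
    using mean_laplacian_times_exp[of lam "\<rho> (fst z)" u "fst z" "snd z"] dim lam
      admissible[OF that] mean_value[OF that]
    by (simp add: sphere_mean_def)
  have local: "\<exists>e>0. C2_on (ball x e) u \<and> laplacian u x + lam\<^sup>2 * u x = 0" if x: "x \<in> D" for x
  proof -
    \<comment> \<open>\<open>R\<close> is tied to the distance from \<open>x\<close> to the
      complement of \<open>D\<close> and not to \<open>\<rho>\<close>; the pointwise condition
      \<open>LU\<close> holds throughout the product ball.\<close>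
    obtain R where R: "R > 0" "cball x R \<subseteq> D"
      using domain(1) x open_contains_cball by blast
    have sub: "fst z \<in> D" if "z \<in> cball (x, 0) R" for z :: "(real ^ 'm) \<times> real"
      using that dist_fst_le[of "(x, 0)" z] by (intro subsetD[OF R(2)]) simp
    have "continuous_on (cball (x, 0) R) U"
      unfolding U_def using sub
      by (intro continuous_intros continuous_on_compose2[OF cont]) auto
    then have C2: "C2_on (ball (x, 0) (R/6)) U" and harm: "laplacian U (x, 0) = 0"
      using mean_laplacian_zero_imp_harmonic[OF R(1) _ LU] sub R(1) by auto
    have "C1_on (ball x (R/6)) (partial_deriv b u)" if "b \<in> Basis" for b
    proof (rule C1_on_slice)
      have "(b, 0::real) \<in> Basis"
        using that by (simp add: Basis_prod_def)
      then show "C1_on (ball (x, 0) (R/6)) (partial_deriv (b, 0) U)"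
        using C2 by (simp add: C2_on_def)
    qed (rule slice)
    moreover have "C1_on (ball x (R/6)) u"
      using C2 by (intro C1_on_slice[where U = U, OF _ U0]) (simp add: C2_on_def)
    ultimately have "C2_on (ball x (R/6)) u"
      by (simp add: C2_on_def)
    moreover have "laplacian u x + lam\<^sup>2 * u x = 0"
    proof -
      \<comment> \<open>The t part of the Laplacian of \<open>U\<close> at t = 0 is lam^2 u(x), so
        harmonicity of \<open>U\<close> at (x, 0) is the desired equation at
        \<open>x\<close>.\<close>
      have "partial_deriv 1 (\<lambda>s. k * exp (lam * s)) = (\<lambda>s. (lam * k) * exp (lam * s))" for k
      proof
        fix s
        have "((\<lambda>s. k * exp (lam * s)) has_derivative (\<lambda>h. h * ((lam * k) * exp (lam * s)))) (at s)"
          by (auto intro!: derivative_eq_intros)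
        from partial_deriv_eq[OF this, of 1]
        show "partial_deriv 1 (\<lambda>s. k * exp (lam * s)) s = (lam * k) * exp (lam * s)"
          by simp
      qed
      then have "laplacian (\<lambda>s. U (x, s)) 0 = lam\<^sup>2 * u x"
        by (simp add: laplacian_def U_def power2_eq_square)
      with harm show ?thesis
        by (simp add: laplacian_prod U0)
    qed
    ultimately show ?thesis
      using R(1) by (intro exI[of _ "R/6"]) simp
  qed
  have "C2_on D u"
    by (rule C2_on_locally) (use local in blast)
  with local show ?thesis
    unfolding metaharmonic_on_def by blast
qed

end
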